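(* Algorithm ChordalGen, on input $n$, outputs a chordal graph $G$ on $n$ vertices, and it runs in time $O\!\left(S+\sum_{i=1}^n |V(T_i)|\right)$, where $T_1,\dots,T_n$ are the subtrees generated in its Step 2 and $O(S)$ is the time the subtree generator used in Step 2 needs to generate $n$ subtrees of a host tree on $n$ nodes.
   Context: Algorithm ChordalGen (input: a positive integer $n$ together with parameters passed to a subtree generator). Step 1: generate a random tree $T$ on $n$ nodes by starting from a single node and, $n-1$ times, choosing a uniformly random existing node and attaching a new node adjacent to it. Step 2: using a subtree generator, generate $n$ non-empty subtrees $T_1,\dots,T_n$ of $T$ (a subtree is a connected subgraph, given as a list of its nodes). Step 3: output as $G$ (e.g. in adjacency-list form) the intersection graph of $\{V(T_1),\dots,V(T_n)\}$, i.e. the graph on vertices $v_1,\dots,v_n$ where $v_i v_j$ ($i\ne j$) is an edge iff $V(T_i)\cap V(T_j)\neq\emptyset$. A graph is chordal if it has no induced cycle of length at least $4$. Running times are in the RAM model where a uniformly random integer from a given interval can be drawn in $O(1)$ time.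
   Formalization: G is output as adjacency lists sharing memory: the list of v_i is given by |V(T_i)|+1 segments of one common array, since with separately written adjacency lists the bound fails (if all T_i are the same single node, G is complete with n(n-1) entries). *)

theory Defs
  imports "HOL-Probability.Probability_Mass_Function"
begin

section \<open>Graphs\<close>

text \<open>A finite simple graph is a vertex set together with a symmetric irreflexive edge
  relation; an undirected edge is present in both orientations.\<close>

definition simple_graph :: "'a set \<Rightarrow> ('a \<times> 'a) set \<Rightarrow> bool" where
  "simple_graph V E \<longleftrightarrow> finite V \<and> E \<subseteq> V \<times> V \<and> sym E \<and> irrefl E"

definition connected_on :: "('a \<times> 'a) set \<Rightarrow> 'a set \<Rightarrow> bool" where
  "connected_on E U \<longleftrightarrow> (\<forall>u\<in>U. \<forall>v\<in>U. (u, v) \<in> (E \<inter> U \<times> U)\<^sup>*)"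

definition has_cycle :: "('a \<times> 'a) set \<Rightarrow> bool" where
  "has_cycle E \<longleftrightarrow> (\<exists>vs. length vs \<ge> 3 \<and> distinct vs \<and>
     (\<forall>i<length vs. (vs ! i, vs ! (Suc i mod length vs)) \<in> E))"

definition tree :: "'a set \<Rightarrow> ('a \<times> 'a) set \<Rightarrow> bool" where
  "tree V E \<longleftrightarrow> simple_graph V E \<and> V \<noteq> {} \<and> connected_on E V \<and> \<not> has_cycle E"

text \<open>In a tree a connected subgraph is induced by its node set, so a subtree may be
  given by its nodes.\<close>

definition subtree_nodes :: "'a set \<Rightarrow> ('a \<times> 'a) set \<Rightarrow> 'a list \<Rightarrow> bool" where
  "subtree_nodes V E us \<longleftrightarrow>
     us \<noteq> [] \<and> distinct us \<and> set us \<subseteq> V \<and> connected_on E (set us)"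

definition induced_cycle :: "'a set \<Rightarrow> ('a \<times> 'a) set \<Rightarrow> 'a list \<Rightarrow> bool" where
  "induced_cycle V E vs \<longleftrightarrow> length vs \<ge> 3 \<and> distinct vs \<and> set vs \<subseteq> V \<and>
     (\<forall>i<length vs. \<forall>j<length vs. (vs ! i, vs ! j) \<in> E \<longleftrightarrow>
        j = Suc i mod length vs \<or> i = Suc j mod length vs)"

definition chordal :: "'a set \<Rightarrow> ('a \<times> 'a) set \<Rightarrow> bool" where
  "chordal V E \<longleftrightarrow> \<not> (\<exists>vs. length vs \<ge> 4 \<and> induced_cycle V E vs)"

definition intersection_edges :: "'a list list \<Rightarrow> (nat \<times> nat) set" where
  "intersection_edges Ts = {(i, j). i < length Ts \<and> j < length Ts \<and> i \<noteq> j \<and>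
     set (Ts ! i) \<inter> set (Ts ! j) \<noteq> {}}"


section \<open>A randomized unit-cost RAM\<close>

text \<open>The memory is divided into finitely many named arrays (as many as a program
  mentions), which a RAM with a single array simulates with constant overhead by
  interleaving.  Scalar variables are cells with index 0.  Every arithmetic operation,
  memory access, branch, loop iteration and random draw costs a constant.
  A program denotes the joint distribution of its final memory and its running time.\<close>

type_synonym mem = "string \<Rightarrow> nat \<Rightarrow> nat"

datatype exp =
    Const nat
  | Get string exp
  | Add exp exp
  | Sub exp exp

primrec val :: "exp \<Rightarrow> mem \<Rightarrow> nat" where
  "val (Const k) s = k"
| "val (Get a e) s = s a (val e s)"
| "val (Add e f) s = val e s + val f s"
| "val (Sub e f) s = val e s - val f s"

primrec ecost :: "exp \<Rightarrow> nat" where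
  "ecost (Const k) = 1"
| "ecost (Get a e) = 1 + ecost e"
| "ecost (Add e f) = 1 + ecost e + ecost f"
| "ecost (Sub e f) = 1 + ecost e + ecost f"

datatype com =
    Skip
  | Store string exp exp
  | Rand string exp exp exp
  | Seq com com  (infixr ";;" 60)
  | If exp com com
  | For string exp com

definition put :: "string \<Rightarrow> nat \<Rightarrow> nat \<Rightarrow> mem \<Rightarrow> mem" where
  "put a i x s = s(a := (s a)(i := x))"

text \<open>Sequential composition; the two running times are added.\<close>

definition bind_time ::
  "('a \<times> nat) pmf \<Rightarrow> ('a \<Rightarrow> ('b \<times> nat) pmf) \<Rightarrow> ('b \<times> nat) pmf" where
  "bind_time p f =
     bind_pmf p (\<lambda>(x, t). map_pmf (\<lambda>(y, t'). (y, t + t')) (f x))"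

definition spend :: "nat \<Rightarrow> ('a \<times> nat) pmf \<Rightarrow> ('a \<times> nat) pmf" where
  "spend c p = map_pmf (\<lambda>(y, t). (y, c + t)) p"

primrec iterate :: "(nat \<Rightarrow> 'a \<Rightarrow> ('a \<times> nat) pmf) \<Rightarrow> nat \<Rightarrow> 'a \<Rightarrow> ('a \<times> nat) pmf" where
  "iterate f 0 s = return_pmf (s, 0)"
| "iterate f (Suc m) s = bind_time (iterate f m s) (f m)"

text \<open>\<open>Rand a i l h\<close> stores a uniformly random element of \<open>{l..h}\<close> in cell \<open>i\<close> of array
  \<open>a\<close>; it is to be used with a nonempty interval only.  \<open>If e c d\<close> runs \<open>c\<close> iff \<open>e\<close> is
  nonzero.  \<open>For x e c\<close> runs \<open>c\<close> with \<open>x = 0, \<dots>, m - 1\<close> for the value \<open>m\<close> of \<open>e\<close>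
  on entry.\<close>

primrec exec :: "com \<Rightarrow> mem \<Rightarrow> (mem \<times> nat) pmf" where
  "exec Skip s = return_pmf (s, 1)"
| "exec (Store a i e) s = return_pmf (put a (val i s) (val e s) s, 1 + ecost i + ecost e)"
| "exec (Rand a i l h) s =
     map_pmf (\<lambda>x. (put a (val i s) x s, 1 + ecost i + ecost l + ecost h))
       (pmf_of_set {val l s..val h s})"
| "exec (c ;; d) s = bind_time (exec c s) (exec d)"
| "exec (If e c d) s =
     spend (1 + ecost e) (if val e s \<noteq> 0 then exec c s else exec d s)"
| "exec (For x e c) s =
     spend (1 + ecost e)
       (iterate (\<lambda>k s. spend 1 (exec c (put x 0 k s))) (val e s) s)"

abbreviation Var :: "string \<Rightarrow> exp" where
  "Var x \<equiv> Get x (Const 0)"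


section \<open>The algorithm\<close>

text \<open>Nodes are numbered in the order of their creation; \<open>''par''\<close> stores for each node
  other than 0 the node it was attached to.\<close>

definition host_tree_prog :: com where
  "host_tree_prog =
     For ''k'' (Sub (Var ''n'') (Const 1))
       (Rand ''par'' (Add (Var ''k'') (Const 1)) (Const 0) (Var ''k''))"

definition host_edges :: "nat \<Rightarrow> (nat \<Rightarrow> nat) \<Rightarrow> (nat \<times> nat) set" where
  "host_edges n par = (\<Union>k\<in>{1..<n}. {(k, par k), (par k, k)})"

text \<open>The node lists of the subtrees are stored consecutively in \<open>''nodes''\<close>; the list of
  the \<open>i\<close>-th subtree begins at \<open>''off'' i\<close> and ends before \<open>''off'' (i + 1)\<close>.\<close>

definition store_subtrees :: "nat list list \<Rightarrow> mem \<Rightarrow> mem" where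
  "store_subtrees Ts s = s
     (''off'' := (\<lambda>i. length (concat (take i Ts))),
      ''nodes'' := (\<lambda>j. if j < length (concat Ts) then concat Ts ! j else 0))"

abbreviation subtree_size :: "exp \<Rightarrow> exp" where
  "subtree_size i \<equiv> Sub (Get ''off'' (Add i (Const 1))) (Get ''off'' i)"

abbreviation subtree_node :: "exp \<Rightarrow> exp \<Rightarrow> exp" where
  "subtree_node i k \<equiv> Get ''nodes'' (Add (Get ''off'' i) k)"

text \<open>Every node is attached to one of smaller number, so the node of a subtree closest
  to node 0 is its minimum, called its root here.\<close>

definition roots_prog :: com where
  "roots_prog =
     For ''i'' (Var ''n'')
       (Store ''root'' (Var ''i'') (subtree_node (Var ''i'') (Const 0)) ;;
        For ''k'' (subtree_size (Var ''i''))
          (If (Sub (Get ''root'' (Var ''i'')) (subtree_node (Var ''i'') (Var ''k'')))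
             (Store ''root'' (Var ''i'') (subtree_node (Var ''i'') (Var ''k'')))
             Skip))"

text \<open>Compute in \<open>''bucket''\<close>, for each node \<open>x\<close>, a contiguous block (from \<open>''start'' x\<close>
  to before \<open>''start'' (x + 1)\<close>) with the indices of all subtrees containing \<open>x\<close>, those
  with root \<open>x\<close> first (these end before \<open>''mid'' x\<close>).  The occurrence of \<open>i\<close> in the block
  of its own root is at position \<open>''pos'' i\<close>.\<close>

definition buckets_prog :: com where
  "buckets_prog =
     For ''x'' (Var ''n'') (Store ''cnt'' (Var ''x'') (Const 0)) ;;
     For ''k'' (Get ''off'' (Var ''n''))
       (Store ''x'' (Const 0) (Get ''nodes'' (Var ''k'')) ;;
        Store ''cnt'' (Var ''x'') (Add (Get ''cnt'' (Var ''x'')) (Const 1))) ;;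
     Store ''start'' (Const 0) (Const 0) ;;
     For ''x'' (Var ''n'')
       (Store ''fill'' (Var ''x'') (Get ''start'' (Var ''x'')) ;;
        Store ''start'' (Add (Var ''x'') (Const 1))
          (Add (Get ''start'' (Var ''x'')) (Get ''cnt'' (Var ''x'')))) ;;
     For ''i'' (Var ''n'')
       (Store ''x'' (Const 0) (Get ''root'' (Var ''i'')) ;;
        Store ''pos'' (Var ''i'') (Get ''fill'' (Var ''x'')) ;;
        Store ''bucket'' (Get ''fill'' (Var ''x'')) (Var ''i'') ;;
        Store ''fill'' (Var ''x'') (Add (Get ''fill'' (Var ''x'')) (Const 1))) ;;
     For ''x'' (Var ''n'') (Store ''mid'' (Var ''x'') (Get ''fill'' (Var ''x''))) ;;
     For ''i'' (Var ''n'')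
       (For ''k'' (subtree_size (Var ''i''))
         (Store ''x'' (Const 0) (subtree_node (Var ''i'') (Var ''k'')) ;;
          If (Sub (Var ''x'') (Get ''root'' (Var ''i'')))
            (Store ''bucket'' (Get ''fill'' (Var ''x'')) (Var ''i'') ;;
             Store ''fill'' (Var ''x'') (Add (Get ''fill'' (Var ''x'')) (Const 1)))
            Skip))"

text \<open>Two subtrees intersect iff the root of one of them belongs to the other.  Hence the
  neighbours of \<open>i\<close> are, without repetition, the subtrees other than \<open>i\<close> containing the root
  of \<open>i\<close>, and those whose root is one of the other nodes of subtree \<open>i\<close>.  All of these
  form \<open>size + 1\<close> contiguous segments of \<open>''bucket''\<close>, which are recorded by their bounds
  \<open>''lo''\<close> and \<open>''hi''\<close>.\<close>

definition adjacency_prog :: com where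
  "adjacency_prog =
     For ''i'' (Var ''n'')
       (Store ''adj'' (Var ''i'') (Add (Get ''off'' (Var ''i'')) (Var ''i'')) ;;
        For ''k'' (subtree_size (Var ''i''))
          (Store ''x'' (Const 0) (subtree_node (Var ''i'') (Var ''k'')) ;;
           Store ''j'' (Const 0) (Add (Get ''adj'' (Var ''i'')) (Var ''k'')) ;;
           Store ''lo'' (Var ''j'') (Get ''start'' (Var ''x'')) ;;
           If (Sub (Var ''x'') (Get ''root'' (Var ''i'')))
             (Store ''hi'' (Var ''j'') (Get ''mid'' (Var ''x'')))
             (Store ''hi'' (Var ''j'') (Get ''pos'' (Var ''i'')))) ;;
        Store ''j'' (Const 0)
          (Add (Get ''adj'' (Var ''i'')) (subtree_size (Var ''i''))) ;;
        Store ''lo'' (Var ''j'') (Add (Get ''pos'' (Var ''i'')) (Const 1)) ;;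
        Store ''hi'' (Var ''j'')
          (Get ''start'' (Add (Get ''root'' (Var ''i'')) (Const 1)))) ;;
     Store ''adj'' (Var ''n'') (Add (Get ''off'' (Var ''n'')) (Var ''n''))"

definition intersection_graph_prog :: com where
  "intersection_graph_prog = roots_prog ;; buckets_prog ;; adjacency_prog"

text \<open>The output format: adjacency lists that may share memory.  The list of vertex \<open>i\<close> is
  the concatenation of the segments numbered from \<open>''adj'' i\<close> to before \<open>''adj'' (i + 1)\<close>.
  Sharing is indispensable: if all subtrees are the same single node then \<open>G\<close> is complete,
  and writing out its \<open>n * (n - 1)\<close> adjacency list entries takes quadratic time, although
  the total size of the subtrees is only \<open>n\<close>.\<close>

definition adjacency_list :: "mem \<Rightarrow> nat \<Rightarrow> nat list" where
  "adjacency_list s i =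
     concat (map (\<lambda>j. map (s ''bucket'') [s ''lo'' j..<s ''hi'' j])
       [s ''adj'' i..<s ''adj'' (Suc i)])"

definition holds_graph :: "mem \<Rightarrow> nat \<Rightarrow> (nat \<times> nat) set \<Rightarrow> bool" where
  "holds_graph s n E \<longleftrightarrow>
     (\<forall>i<n. distinct (adjacency_list s i) \<and> set (adjacency_list s i) = {j. (i, j) \<in> E})"

text \<open>A subtree generator, given its parameters (of any type \<open>'p\<close>), a number \<open>n\<close> and a host
  tree on the nodes \<open>{..<n}\<close>, returns random node lists of \<open>n\<close> subtrees and the time it took
  (including any access to the tree and writing the node lists).\<close>

type_synonym 'p generator =
  "'p \<Rightarrow> nat \<Rightarrow> (nat \<times> nat) set \<Rightarrow> (nat list list \<times> nat) pmf"

definition subtree_generator :: "'p generator \<Rightarrow> bool" where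
  "subtree_generator gen \<longleftrightarrow>
     (\<forall>p n T Ts t. tree {..<n} T \<and> (Ts, t) \<in> set_pmf (gen p n T) \<longrightarrow>
        length Ts = n \<and> (\<forall>us\<in>set Ts. subtree_nodes {..<n} T us))"

definition init_mem :: "nat \<Rightarrow> mem" where
  "init_mem n = put ''n'' 0 n (\<lambda>a i. 0)"

text \<open>An outcome \<open>((T, Ts, s), t)\<close> consists of the host tree, the subtrees, the final memory
  containing the output graph, and the running time.\<close>

definition chordal_gen ::
  "'p generator \<Rightarrow> 'p \<Rightarrow> nat \<Rightarrow> (((nat \<times> nat) set \<times> nat list list \<times> mem) \<times> nat) pmf" where
  "chordal_gen gen p n =
     bind_time (exec host_tree_prog (init_mem n)) (\<lambda>s1.
       let T = host_edges n (s1 ''par'') in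
       bind_time (gen p n T) (\<lambda>Ts.
         bind_time (exec intersection_graph_prog (store_subtrees Ts s1)) (\<lambda>s.
           return_pmf ((T, Ts, s), 0))))"

end

theory Submission
  imports Defs
begin

text \<open>A subtree that contains a node other than its root also contains the parent of that
  node, hence a lowest common node of two subtrees is the root of one of them.  So two subtrees
  intersect iff one contains the root of the other.  This gives both the chordality of the
  intersection graph and the correctness of the adjacency lists, which are put together from
  the subtrees containing the root of \<open>i\<close> and those rooted at another node of \<open>i\<close>.
  For the running time, a loop over the nodes of subtree \<open>i\<close> increases \<open>off i\<close>, the total
  size of the subtrees before \<open>i\<close>, to \<open>off (i + 1)\<close>; hence each outer loop has an invariant
  that bounds the time by a multiple of \<open>i + off i\<close>, and \<open>n \<le> off n\<close> as subtrees are
  nonempty.\<close>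


section \<open>Subtrees of the host tree\<close>

lemma host_edges_iff:
  "(u, v) \<in> host_edges n par \<longleftrightarrow>
     (1 \<le> u \<and> u < n \<and> v = par u) \<or> (1 \<le> v \<and> v < n \<and> u = par v)"
  by (auto simp: host_edges_def)

text \<open>Applied at a position that holds a largest value. On a host cycle,
  \<open>p \<noteq> q\<close> gives two different neighbours. On an induced cycle, the last two
  facts exclude that \<open>p\<close> and \<open>q\<close> are consecutive, as \<open>q\<close>
  follows \<open>p\<close> only if \<open>q = i\<close>.\<close>

lemma cyclic_neighbours:
  fixes i L :: nat
  assumes "i < L" "3 \<le> L"
  obtains p q where "p < L" "q < L" "q = Suc i mod L" "i = Suc p mod L" "p \<noteq> q"
    "4 \<le> L \<Longrightarrow> p \<noteq> Suc q mod L" "q \<noteq> i"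
proof -
  define q where "q = (if Suc i = L then 0 else Suc i)"
  define p where "p = (if i = 0 then L - 1 else i - 1)"
  show thesis
  proof (rule that)
    show "q = Suc i mod L" "i = Suc p mod L"
      using assms by (auto simp: p_def q_def)
    show "p \<noteq> Suc q mod L" if "4 \<le> L"
      using assms that by (cases "Suc q = L") (auto simp: p_def q_def split: if_splits)
  qed (use assms in \<open>auto simp: p_def q_def split: if_splits\<close>)
qed

text \<open>Parents are strictly smaller, so every node has a path to 0. On a cycle, both neighbours
  of the largest node would have to be its parent.\<close>

lemma tree_host_edges:
  assumes "n \<ge> 1" and par: "\<And>k. 1 \<le> k \<Longrightarrow> k < n \<Longrightarrow> par k < k"
  shows "tree {..<n} (host_edges n par)"
proof -
  let ?E = "host_edges n par"
  have sub: "?E \<subseteq> {..<n} \<times> {..<n}"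
    using par by (fastforce simp: host_edges_iff)
  have sym: "sym ?E"
    by (auto simp: sym_def host_edges_iff)
  have "irrefl ?E"
    using par by (fastforce simp: irrefl_def host_edges_iff)
  moreover have "connected_on ?E {..<n}"
  proof -
    have down: "v < n \<Longrightarrow> (v, 0) \<in> ?E\<^sup>*" for v
    proof (induction v rule: less_induct)
      case (less v)
      show ?case
      proof (cases "v = 0")
        case False
        then have "par v < v" "(v, par v) \<in> ?E"
          using less.prems par by (auto simp: host_edges_iff)
        with less show ?thesis
          by (meson converse_rtrancl_into_rtrancl less_trans)
      qed simp
    qed
    have "(u, v) \<in> ?E\<^sup>*" if "u < n" "v < n" for u v
      using down[OF that(1)] down[OF that(2)] sym_rtrancl[OF sym]
      by (meson rtrancl_trans symD)
    then show ?thesis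
      using sub by (simp add: connected_on_def Int_absorb2)
  qed
  moreover have "\<not> has_cycle ?E"
  proof
    assume "has_cycle ?E"
    then obtain vs where vs: "length vs \<ge> 3" "distinct vs"
      and cyc: "\<And>i. i < length vs \<Longrightarrow> (vs ! i, vs ! (Suc i mod length vs)) \<in> ?E"
      unfolding has_cycle_def by blast
    have "Max (set vs) \<in> set vs"
      using vs by (intro Max_in) auto
    then obtain i where i: "i < length vs" "vs ! i = Max (set vs)"
      by (auto simp: in_set_conv_nth)
    obtain p q where pq: "p < length vs" "q < length vs" "q = Suc i mod length vs"
      "i = Suc p mod length vs" "p \<noteq> q"
      using cyclic_neighbours[OF i(1) vs(1)] by metis
    have "vs ! p \<le> vs ! i" "vs ! q \<le> vs ! i"
      using pq i by auto
    moreover have "(vs ! i, vs ! q) \<in> ?E" "(vs ! p, vs ! i) \<in> ?E"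
      using cyc[of i] cyc[of p] pq(1,3,4) i(1) by simp_all
    ultimately have "vs ! p = par (vs ! i)" "vs ! q = par (vs ! i)"
      using par by (fastforce simp: host_edges_iff)+
    then show False
      using vs pq nth_eq_iff_index_eq by metis
  qed
  ultimately show ?thesis
    using assms(1) sub sym by (auto simp: tree_def simple_graph_def lessThan_empty_iff)
qed

text \<open>Otherwise a path inside \<open>U\<close> from \<open>v\<close> to \<open>r\<close> could
  not leave the descendants of \<open>v\<close>, none of which is smaller than
  \<open>v\<close>.\<close>

lemma parent_in_subtree:
  assumes par: "\<And>k. 1 \<le> k \<Longrightarrow> k < n \<Longrightarrow> par k < k"
    and con: "connected_on (host_edges n par) U"
    and "v \<in> U" "r \<in> U" "r < v"
  shows "par v \<in> U"
proof (rule ccontr)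
  assume "par v \<notin> U"
  \<comment> \<open>\<open>(x, v) \<in> ?P\<^sup>*\<close> means that \<open>x\<close> is a
    descendant of \<open>v\<close>.\<close>
  let ?P = "{(k, par k) | k. 1 \<le> k \<and> k < n}"
  have "(v, r) \<in> (host_edges n par \<inter> U \<times> U)\<^sup>*"
    using con assms by (simp add: connected_on_def)
  \<comment> \<open>the only edge that leaves the descendants of \<open>v\<close> goes to the parent of \<open>v\<close>\<close>
  then have "(r, v) \<in> ?P\<^sup>*"
  proof (induction rule: rtrancl_induct)
    case (step w w')
    then consider "1 \<le> w" "w < n" "w' = par w" "w' \<in> U" | "(w', w) \<in> ?P"
      by (auto simp: host_edges_iff)
    then show ?case
    proof cases
      case 1
      then have "w \<noteq> v"
        using \<open>par v \<notin> U\<close> by auto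
      with step.IH obtain y where "(w, y) \<in> ?P" "(y, v) \<in> ?P\<^sup>*"
        by (meson converse_rtranclE)
      with 1 show ?thesis
        by auto
    next
      case 2
      then show ?thesis
        using step.IH by (rule converse_rtrancl_into_rtrancl)
    qed
  qed simp
  then have "v \<le> r"
    by (induction rule: converse_rtrancl_induct) (use par in fastforce)+
  with \<open>r < v\<close> show False
    by simp
qed

text \<open>Take the smallest common node. If it is the root of neither set, then both contain its
  parent, which is a smaller common node.\<close>

lemma intersecting_subtrees_root:
  assumes par: "\<And>k. 1 \<le> k \<Longrightarrow> k < n \<Longrightarrow> par k < k"
    and U: "connected_on (host_edges n par) U" "finite U"
    and W: "connected_on (host_edges n par) W" "finite W"
    and int: "U \<inter> W \<noteq> {}"
  shows "Min U \<in> W \<or> Min W \<in> U"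
proof (rule ccontr)
  assume no_root: "\<not> ?thesis"
  let ?w = "Min (U \<inter> W)"
  have fin: "finite (U \<inter> W)"
    using U by simp
  have w: "?w \<in> U" "?w \<in> W"
    using Min_in[OF fin int] by auto
  have min_in: "Min U \<in> U" "Min W \<in> W"
    using w U W by (auto intro!: Min_in)
  have "Min U < ?w" "Min W < ?w"
    using w min_in no_root U W by (metis Min_le order_le_less)+
  then have par_in: "par ?w \<in> U \<inter> W"
    using parent_in_subtree[OF par U(1)] parent_in_subtree[OF par W(1)] w min_in by blast
  \<comment> \<open>That \<open>?w\<close> lies in the range where \<open>par\<close> decreases is
    read off from the first edge of a path to \<open>Min U\<close>.\<close>
  have "(?w, Min U) \<in> (host_edges n par \<inter> U \<times> U)\<^sup>*" "?w \<noteq> Min U"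
    using U(1) w min_in no_root by (auto simp: connected_on_def)
  then obtain y where "(?w, y) \<in> host_edges n par"
    by (meson IntE converse_rtranclE)
  then have "?w < n"
    using par \<open>Min U < ?w\<close> by (fastforce simp: host_edges_iff)
  then have "par ?w < ?w"
    using par \<open>Min U < ?w\<close> by simp
  moreover have "?w \<le> par ?w"
    using par_in fin by simp
  ultimately show False
    by simp
qed

section \<open>Chordality of the intersection graph\<close>

lemma simple_graph_intersection_edges: "simple_graph {..<length Ts} (intersection_edges Ts)"
  by (auto simp: simple_graph_def intersection_edges_def sym_def irrefl_def)

text \<open>On a cycle of \<open>G\<close>, the two neighbours of a vertex whose root is largest both contain
  that root, so they are adjacent.\<close>

lemma chordal_intersection_edges:
  assumes root: "\<And>i j. (i, j) \<in> intersection_edges Ts \<Longrightarrow>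
      Min (set (Ts ! i)) \<in> set (Ts ! j) \<or> Min (set (Ts ! j)) \<in> set (Ts ! i)"
  shows "chordal V (intersection_edges Ts)"
  unfolding chordal_def
proof (intro notI, elim exE conjE)
  fix vs
  let ?E = "intersection_edges Ts" and ?r = "\<lambda>i. Min (set (Ts ! i))"
  assume len: "4 \<le> length vs" and "induced_cycle V ?E vs"
  then have vs: "distinct vs"
    and cyc: "\<And>i j. i < length vs \<Longrightarrow> j < length vs \<Longrightarrow> (vs ! i, vs ! j) \<in> ?E \<longleftrightarrow>
        j = Suc i mod length vs \<or> i = Suc j mod length vs"
    by (auto simp: induced_cycle_def)
  have "Max (?r ` set vs) \<in> ?r ` set vs"
    using len by (intro Max_in) auto
  then obtain i where i: "i < length vs" "?r (vs ! i) = Max (?r ` set vs)"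
    by (auto simp: in_set_conv_nth)
  have three: "3 \<le> length vs"
    using len by simp
  obtain p q where pq: "p < length vs" "q < length vs" "q = Suc i mod length vs"
      "i = Suc p mod length vs" "p \<noteq> q" "p \<noteq> Suc q mod length vs" "q \<noteq> i"
    using cyclic_neighbours[OF i(1)] len by (metis (no_types) three)
  \<comment> \<open>If instead the root of \<open>j\<close> lies in \<open>Ts ! (vs ! i)\<close>, it
    is at least \<open>?r (vs ! i)\<close>, hence equal to it by maximality.\<close>
  have contains_root: "?r (vs ! i) \<in> set (Ts ! j)" if "(vs ! i, j) \<in> ?E" "j \<in> set vs" for j
  proof -
    have "?r j \<le> ?r (vs ! i)"
      using that i by simp
    moreover have "?r j \<in> set (Ts ! j)"
      using that by (intro Min_in) (auto simp: intersection_edges_def)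
    ultimately show ?thesis
      using root[OF that(1)] by (metis List.finite_set Min_le dual_order.antisym)
  qed
  have "(vs ! i, vs ! p) \<in> ?E" "(vs ! i, vs ! q) \<in> ?E"
    using cyc[of i p] cyc[of i q] i(1) pq(1-4) by simp_all
  then have "?r (vs ! i) \<in> set (Ts ! (vs ! p))" "?r (vs ! i) \<in> set (Ts ! (vs ! q))"
    "vs ! p < length Ts" "vs ! q < length Ts"
    using contains_root pq by (auto simp: intersection_edges_def)
  moreover have "vs ! p \<noteq> vs ! q"
    using vs pq by (simp add: nth_eq_iff_index_eq)
  ultimately have "(vs ! p, vs ! q) \<in> ?E"
    by (auto simp: intersection_edges_def)
  \<comment> \<open>By \<open>cyc\<close>, \<open>p\<close> and \<open>q\<close> would be
    consecutive. But the successor of \<open>p\<close> is \<open>i\<close> and not \<open>q\<close>,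
    and \<open>p\<close> does not follow \<open>q\<close> on a cycle of length at least 4.\<close>
  then show False
    using cyc pq by metis
qed


section \<open>Weakest preconditions\<close>

text \<open>Ranging over the support covers all possible random draws, so time bounds are worst
  case. As the time is an argument of \<open>R\<close>, one invariant treats correctness and cost
  together.\<close>

definition wp :: "com \<Rightarrow> (mem \<Rightarrow> nat \<Rightarrow> bool) \<Rightarrow> mem \<Rightarrow> bool" where
  "wp c R s \<longleftrightarrow> (\<forall>(s', t)\<in>set_pmf (exec c s). R s' t)"

text \<open>An upper bound for the arrays that a run can modify; it supplies the frame conditions of
  the rules below.\<close>

primrec writes :: "com \<Rightarrow> string set" where
  "writes Skip = {}"
| "writes (Store a i e) = {a}"
| "writes (Rand a i l h) = {a}"
| "writes (c ;; d) = writes c \<union> writes d"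
| "writes (If e c d) = writes c \<union> writes d"
| "writes (For x e c) = insert x (writes c)"

lemma set_pmf_bind_time:
  "set_pmf (bind_time p f) =
     {(y, t + t') | x t y t'. (x, t) \<in> set_pmf p \<and> (y, t') \<in> set_pmf (f x)}"
  by (auto simp: bind_time_def case_prod_unfold) force+

lemma set_pmf_spend: "set_pmf (spend c p) = {(y, c + t) | y t. (y, t) \<in> set_pmf p}"
  by (auto simp: spend_def)

lemma iterate_invariant:
  assumes "(s', t) \<in> set_pmf (iterate f m s)" and "I 0 s 0"
    and "\<And>k s t s' t'. k < m \<Longrightarrow> I k s t \<Longrightarrow> (s', t') \<in> set_pmf (f k s) \<Longrightarrow>
      I (Suc k) s' (t + t')"
  shows "I m s' t"
  using assms
proof (induction m arbitrary: s' t)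
  case (Suc m)
  from Suc.prems(1) obtain r u t' where "(r, u) \<in> set_pmf (iterate f m s)"
    "(s', t') \<in> set_pmf (f m r)" "t = u + t'"
    by (auto simp: set_pmf_bind_time)
  moreover have "I m r u"
    using Suc.IH[OF \<open>(r, u) \<in> _\<close> Suc.prems(2)] Suc.prems(3) less_SucI by blast
  ultimately show ?case
    using Suc.prems(3) by blast
qed simp

lemma put_apply: "put a i x s b j = (if b = a \<and> j = i then x else s b j)"
  by (simp add: put_def)

lemma put_other: "b \<noteq> a \<Longrightarrow> put a i x s b = s b"
  by (simp add: put_def)

lemma exec_unchanged:
  "(s', t) \<in> set_pmf (exec c s) \<Longrightarrow> a \<notin> writes c \<Longrightarrow> s' a = s a"
proof (induction c arbitrary: s s' t)
  case (For x e c)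
  then obtain t' where
    "(s', t') \<in> set_pmf (iterate (\<lambda>k s. spend 1 (exec c (put x 0 k s))) (val e s) s)"
    by (auto simp: set_pmf_spend)
  then show ?case
  proof (rule iterate_invariant[where I = "\<lambda>_ s' _. s' a = s a"])
    fix k r u r' u'
    assume "r a = s a" "(r', u') \<in> set_pmf (spend 1 (exec c (put x 0 k r)))"
    then show "r' a = s a"
      using For.IH For.prems(2) by (fastforce simp: set_pmf_spend put_other)
  qed simp
next
  case (Seq c d)
  then show ?case
    by (fastforce simp: set_pmf_bind_time)
qed (auto simp: set_pmf_spend put_other split: if_splits)

lemma wp_simps:
  "wp Skip R s \<longleftrightarrow> R s 1"
  "wp (Store a i e) R s \<longleftrightarrow> R (put a (val i s) (val e s) s) (1 + ecost i + ecost e)"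
  "wp (c ;; d) R s \<longleftrightarrow> wp c (\<lambda>s' t. wp d (\<lambda>s'' t'. R s'' (t + t')) s') s"
  "wp (If e c d) R s \<longleftrightarrow>
     (if val e s \<noteq> 0 then wp c (\<lambda>s' t. R s' (1 + ecost e + t)) s
      else wp d (\<lambda>s' t. R s' (1 + ecost e + t)) s)"
  by (simp_all add: wp_def set_pmf_bind_time set_pmf_spend) (fastforce+)?

text \<open>The first premise makes the interval nonempty, without which the support of
  \<open>pmf_of_set\<close> is not specified.\<close>

lemma wp_Rand:
  "val l s \<le> val h s \<Longrightarrow> (\<And>x. val l s \<le> x \<Longrightarrow> x \<le> val h s \<Longrightarrow>
     R (put a (val i s) x s) (1 + ecost i + ecost l + ecost h)) \<Longrightarrow> wp (Rand a i l h) R s"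
  by (auto simp: wp_def set_pmf_of_set)

text \<open>The consequence rule with the frame condition built in, so that \<open>Q\<close> need
  not mention the arrays that \<open>c\<close> leaves alone.\<close>

lemma wp_mono:
  assumes "wp c Q s"
    and "\<And>s' t. Q s' t \<Longrightarrow> (\<And>a. a \<notin> writes c \<Longrightarrow> s' a = s a) \<Longrightarrow> R s' t"
  shows "wp c R s"
  unfolding wp_def
proof (intro ballI, clarify)
  fix s' t
  assume exec: "(s', t) \<in> set_pmf (exec c s)"
  with assms(1) have "Q s' t"
    by (auto simp: wp_def)
  then show "R s' t"
    using exec_unchanged[OF exec] by (rule assms(2))
qed

lemma wp_Seq:
  assumes "wp c Q s"
    and "\<And>s' t. Q s' t \<Longrightarrow> (\<And>a. a \<notin> writes c \<Longrightarrow> s' a = s a) \<Longrightarrow>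
      wp d (\<lambda>s'' t'. R s'' (t + t')) s'"
  shows "wp (c ;; d) R s"
  unfolding wp_simps using assms by (rule wp_mono)

text \<open>In \<open>I k s' t\<close>, \<open>t\<close> is the time of the first \<open>k\<close>
  rounds. The \<open>Suc\<close> is the unit charged for each round. The frame condition excepts
  \<open>x\<close> as well, since the loop itself sets the counter.\<close>

lemma wp_For:
  assumes "I 0 s 0"
    and "\<And>k s' t. k < val e s \<Longrightarrow> (\<And>a. a \<noteq> x \<Longrightarrow> a \<notin> writes c \<Longrightarrow> s' a = s a) \<Longrightarrow>
      I k s' t \<Longrightarrow> wp c (\<lambda>s'' t'. I (Suc k) s'' (t + Suc t')) (put x 0 k s')"
    and "\<And>s' t. (\<And>a. a \<noteq> x \<Longrightarrow> a \<notin> writes c \<Longrightarrow> s' a = s a) \<Longrightarrow> I (val e s) s' t \<Longrightarrow>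
      R s' (1 + ecost e + t)"
  shows "wp (For x e c) R s"
  unfolding wp_def
proof (intro ballI, clarify)
  fix s' t
  assume "(s', t) \<in> set_pmf (exec (For x e c) s)"
  then obtain u where t: "t = 1 + ecost e + u" and
    iter: "(s', u) \<in> set_pmf (iterate (\<lambda>k s. spend 1 (exec c (put x 0 k s))) (val e s) s)"
    by (auto simp: set_pmf_spend)
  let ?I = "\<lambda>k s' t. (\<forall>a. a \<noteq> x \<longrightarrow> a \<notin> writes c \<longrightarrow> s' a = s a) \<and> I k s' t"
  have "?I (val e s) s' u"
  proof (rule iterate_invariant[OF iter])
    fix k r w r' w'
    assume k: "k < val e s" and I: "?I k r w"
      and "(r', w') \<in> set_pmf (spend 1 (exec c (put x 0 k r)))"
    then obtain w'' where w: "w' = Suc w''" "(r', w'') \<in> set_pmf (exec c (put x 0 k r))"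
      by (auto simp: set_pmf_spend)
    have "I (Suc k) r' (w + Suc w'')"
      using assms(2)[of k r w] k I w(2) unfolding wp_def by blast
    moreover have "r' a = s a" if "a \<noteq> x" "a \<notin> writes c" for a
      using exec_unchanged[OF w(2)] I that by (simp add: put_other)
    ultimately show "?I (Suc k) r' (w + w')"
      using w by blast
  qed (use assms(1) in simp)
  then show "R s' t"
    using assms(3) t by blast
qed


section \<open>Roots of the subtrees\<close>

text \<open>What the array program needs of the node lists. The tree structure enters only through
  the separate hypothesis that of two intersecting subtrees one contains the root of the
  other.\<close>

locale subtree_family =
  fixes n :: nat and Ts :: "nat list list"
  assumes length_Ts: "length Ts = n"
    and nonempty: "i < n \<Longrightarrow> Ts ! i \<noteq> []"
    and distinct: "i < n \<Longrightarrow> distinct (Ts ! i)"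
    and bounded: "i < n \<Longrightarrow> set (Ts ! i) \<subseteq> {..<n}"
begin

definition off :: "nat \<Rightarrow> nat" where
  "off i = length (concat (take i Ts))"

definition rt :: "nat \<Rightarrow> nat" where
  "rt i = Min (set (Ts ! i))"

definition input :: "mem \<Rightarrow> bool" where
  "input s \<longleftrightarrow> s ''n'' 0 = n \<and> (\<forall>i\<le>n. s ''off'' i = off i) \<and>
     (\<forall>j<off n. s ''nodes'' j = concat Ts ! j)"

lemma off_0: "off 0 = 0"
  by (simp add: off_def)

lemma off_Suc: "i < n \<Longrightarrow> off (Suc i) = off i + length (Ts ! i)"
  by (simp add: off_def take_Suc_conv_app_nth length_Ts)

lemma off_n: "off n = length (concat Ts)"
  by (simp add: off_def length_Ts)

lemma concat_nth:
  assumes "i < n" "k < length (Ts ! i)"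
  shows "concat Ts ! (off i + k) = Ts ! i ! k" and "off i + k < off n"
proof -
  have "concat Ts = concat (take i Ts) @ Ts ! i @ concat (drop (Suc i) Ts)"
    using assms by (metis concat.simps(2) concat_append id_take_nth_drop length_Ts)
  with assms show "concat Ts ! (off i + k) = Ts ! i ! k" "off i + k < off n"
    unfolding off_n by (auto simp: off_def nth_append)
qed

lemma input_simps:
  assumes "input s"
  shows "s ''n'' 0 = n" "i \<le> n \<Longrightarrow> s ''off'' i = off i"
    "i < n \<Longrightarrow> off (Suc i) = off i + length (Ts ! i)"
    "i < n \<Longrightarrow> k < length (Ts ! i) \<Longrightarrow> s ''nodes'' (off i + k) = Ts ! i ! k"
  using assms concat_nth by (auto simp: input_def off_Suc)

lemma input_cong:
  "input s \<Longrightarrow> s' ''n'' = s ''n'' \<Longrightarrow> s' ''off'' = s ''off'' \<Longrightarrow> s' ''nodes'' = s ''nodes'' \<Longrightarrow> input s'"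
  by (simp add: input_def)

lemma rt_in: "i < n \<Longrightarrow> rt i \<in> set (Ts ! i)"
  using nonempty by (auto simp: rt_def)

lemma rt_le: "x \<in> set (Ts ! i) \<Longrightarrow> rt i \<le> x"
  by (simp add: rt_def)

lemma nth_lt: "i < n \<Longrightarrow> k < length (Ts ! i) \<Longrightarrow> Ts ! i ! k < n"
  using bounded nth_mem by blast

lemma rt_lt: "i < n \<Longrightarrow> rt i < n"
  using bounded rt_in by blast

lemma wp_roots:
  assumes "input s"
  shows "wp roots_prog (\<lambda>s' t. (\<forall>i<n. s' ''root'' i = rt i) \<and> t \<le> 3 + 100 * n + 100 * off n) s"
  unfolding roots_prog_def
\<comment> \<open>Here and below the coefficients are generous roundings; the summand 3 in the bound
  is the cost of entering a loop over \<open>Var ''n''\<close>.\<close>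
proof (rule wp_For[where I = "\<lambda>i s' t. (\<forall>i'<i. s' ''root'' i' = rt i') \<and>
    t \<le> 100 * i + 100 * off i"], goal_cases)
  case (2 i s' t)
  have i: "i < n"
    using 2 assms by (simp add: input_simps)
  have inp: "input s'"
    using input_cong[OF assms] 2 by simp
  have "wp (For ''k'' (subtree_size (Var ''i''))
      (If (Sub (Get ''root'' (Var ''i'')) (subtree_node (Var ''i'') (Var ''k'')))
        (Store ''root'' (Var ''i'') (subtree_node (Var ''i'') (Var ''k''))) Skip))
      (\<lambda>s'' t'. (\<forall>i'<i. s'' ''root'' i' = rt i') \<and> s'' ''root'' i = rt i \<and>
        t' \<le> 12 + 40 * length (Ts ! i)) r"
    if r: "input r" "r ''i'' 0 = i" "r ''root'' i = Ts ! i ! 0"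
      "\<forall>i'<i. r ''root'' i' = rt i'" for r
  \<comment> \<open>A running minimum. Since \<open>root\<close> is initialised with the first
    entry, that entry is inserted and \<open>Min\<close> is never applied to the empty set.\<close>
  proof (rule wp_For[where I = "\<lambda>k r' t'. (\<forall>i'<i. r' ''root'' i' = rt i') \<and>
      r' ''root'' i = Min (insert (Ts ! i ! 0) (set (take k (Ts ! i)))) \<and> t' \<le> 40 * k"], goal_cases)
    case (2 k r' t')
    have k: "k < length (Ts ! i)"
      using 2 i r by (simp add: input_simps)
    have inp': "input r'" "r' ''i'' 0 = i"
      using input_cong[OF r(1)] 2 r by simp_all
    have "Min (insert (Ts ! i ! 0) (set (take (Suc k) (Ts ! i)))) =
        Min (insert (Ts ! i ! k) (insert (Ts ! i ! 0) (set (take k (Ts ! i)))))"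
      by (simp add: take_Suc_conv_app_nth k insert_commute)
    also have "\<dots> = min (Ts ! i ! k) (r' ''root'' i)"
      using 2 by simp
    \<comment> \<open>Subtraction is cut off at 0, so a nonzero difference means that the new entry
      is strictly smaller.\<close>
    finally have "Min (insert (Ts ! i ! 0) (set (take (Suc k) (Ts ! i)))) =
        (if r' ''root'' i - Ts ! i ! k \<noteq> 0 then Ts ! i ! k else r' ''root'' i)"
      by auto
    then show ?case
      using 2 i k inp' r(1) by (simp add: wp_simps put_apply input_simps)
  next
    case (3 r' t')
    have "Ts ! i ! 0 \<in> set (Ts ! i)"
      using nonempty[OF i] by simp
    then show ?case
      using 3 i r by (simp add: input_simps rt_def insert_absorb)
  qed (use r in simp)
  note inner = this
  show ?case
    unfolding wp_simps
  proof (rule wp_mono[OF inner], goal_cases)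
    case 1
    show ?case
      using input_cong[OF inp] by (simp add: put_other)
  next
    case (5 s'' t')
    then show ?case
      using 2 i by (auto simp: off_Suc less_Suc_eq)
  qed (use 2 i inp assms input_simps(4)[OF assms i, of 0] nonempty[OF i] in
      \<open>simp_all add: put_apply input_simps\<close>)
next
  case (3 s' t)
  then show ?case
    using assms by (simp add: input_simps)
qed simp


section \<open>The subtrees containing a node\<close>

definition containing :: "nat \<Rightarrow> nat set" where
  "containing x = {i. i < n \<and> x \<in> set (Ts ! i)}"

definition rooted :: "nat \<Rightarrow> nat set" where
  "rooted x = {i. i < n \<and> rt i = x}"

text \<open>Prefix sums as in counting sort: block \<open>x\<close> has room for exactly the
  subtrees containing \<open>x\<close>.\<close>

definition bstart :: "nat \<Rightarrow> nat" where
  "bstart x = (\<Sum>y<x. card (containing y))"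

text \<open>The state of a partial filling: \<open>f x\<close> is the first free position of block
  \<open>x\<close>, and \<open>A x\<close> holds the indices entered so far, without gaps or
  repetitions.\<close>

definition blocks :: "(nat \<Rightarrow> nat) \<Rightarrow> (nat \<Rightarrow> nat) \<Rightarrow> (nat \<Rightarrow> nat set) \<Rightarrow> bool" where
  "blocks f b A \<longleftrightarrow> (\<forall>x<n. bstart x \<le> f x \<and> bij_betw b {bstart x..<f x} (A x))"

lemma finite_containing: "finite (containing x)"
  by (simp add: containing_def)

lemma rooted_subset: "rooted x \<subseteq> containing x"
  using rt_in by (auto simp: rooted_def containing_def)

lemma bstart_Suc: "bstart (Suc x) = bstart x + card (containing x)"
  by (simp add: bstart_def)

lemma bstart_mono: "x \<le> y \<Longrightarrow> bstart x \<le> bstart y"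
  by (auto simp: bstart_def intro: sum_mono2)

lemma bstart_block_unique:
  assumes "bstart x \<le> p" "p < bstart (Suc x)" "bstart y \<le> p" "p < bstart (Suc y)"
  shows "x = y"
proof (rule linorder_cases[of x y])
  assume "x < y"
  then show ?thesis
    using assms bstart_mono[of "Suc x" y] by simp
next
  assume "y < x"
  then show ?thesis
    using assms bstart_mono[of "Suc y" x] by simp
qed

lemma block_end:
  assumes "blocks f b A" "x < n"
  shows "f x = bstart x + card (A x)"
  using assms bij_betw_same_card[of b "{bstart x..<f x}" "A x"] by (auto simp: blocks_def)

text \<open>As \<open>A x\<close> is part of \<open>containing x\<close>, no block overflows, and
  since \<open>i\<close> is new, block \<open>y\<close> has a free cell at \<open>f y\<close>. The
  second conclusion says that this cell has not been filled before, so earlier entries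
  survive.\<close>

lemma blocks_insert:
  assumes blocks: "blocks f b A" and sub: "\<And>x. x < n \<Longrightarrow> A x \<subseteq> containing x"
    and y: "y < n" "i \<in> containing y" "i \<notin> A y"
  shows "blocks (f(y := Suc (f y))) (b(f y := i)) (A(y := insert i (A y)))"
    and "\<And>x p. x < n \<Longrightarrow> bstart x \<le> p \<Longrightarrow> p < f x \<Longrightarrow> p \<noteq> f y"
proof -
  have le: "f x \<le> bstart (Suc x)" if "x < n" for x
    using block_end[OF blocks that] card_mono[OF finite_containing sub[OF that]]
    by (simp add: bstart_Suc)
  have "card (A y) < card (containing y)"
    using y sub[OF y(1)] by (intro psubset_card_mono finite_containing) auto
  then have "f y < bstart (Suc y)"
    using block_end[OF blocks y(1)] by (simp add: bstart_Suc)
  moreover have "bstart y \<le> f y"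
    using blocks y(1) by (simp add: blocks_def)
  ultimately show fresh: "p \<noteq> f y" if "x < n" "bstart x \<le> p" "p < f x" for x p
    using that le[OF that(1)] bstart_block_unique[of x p y] by auto
  show "blocks (f(y := Suc (f y))) (b(f y := i)) (A(y := insert i (A y)))"
    unfolding blocks_def
  proof (intro allI impI)
    fix x
    assume x: "x < n"
    then have bij: "bstart x \<le> f x" "bij_betw b {bstart x..<f x} (A x)"
      using blocks by (auto simp: blocks_def)
    have bij': "bij_betw (b(f y := i)) {bstart x..<f x} (A x)"
      using fresh[OF x] by (intro bij_betw_cong[THEN iffD1, OF _ bij(2)]) auto
    show "bstart x \<le> (f(y := Suc (f y))) x \<and>
        bij_betw (b(f y := i)) {bstart x..<(f(y := Suc (f y))) x} ((A(y := insert i (A y))) x)"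
    proof (cases "x = y")
      case True
      have "bij_betw (b(f y := i)) ({bstart y..<f y} \<union> {f y}) (A y \<union> {(b(f y := i)) (f y)})"
        using bij' y(3) True by (subst notIn_Un_bij_betw3[symmetric]) auto
      then show ?thesis
        using True bij(1) by (simp add: atLeastLessThanSuc)
    qed (use bij(1) bij' in simp)
  qed
qed

text \<open>Each list is distinct, so a subtree contributes at most one occurrence of
  \<open>x\<close>. Hence the counting loop computes the block sizes.\<close>

lemma count_concat: "count_list (concat Ts) x = card (containing x)"
proof -
  have count: "count_list u x = (if x \<in> set u then 1 else 0)" if "distinct u" for u
    using that by (induction u) auto
  have "count_list (concat us) x = length (filter (\<lambda>u. x \<in> set u) us)"
    if "\<forall>u\<in>set us. distinct u" for us :: "nat list list"
    using that by (induction us) (auto simp: count)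
  then have "count_list (concat Ts) x = length (filter (\<lambda>u. x \<in> set u) Ts)"
    using distinct length_Ts by (metis in_set_conv_nth)
  then show ?thesis
    by (simp add: length_filter_conv_card containing_def length_Ts)
qed

section \<open>The loops that fill the buckets, one by one\<close>

abbreviation "zero_loop \<equiv> For ''x'' (Var ''n'') (Store ''cnt'' (Var ''x'') (Const 0))"

abbreviation "count_loop \<equiv> For ''k'' (Get ''off'' (Var ''n''))
  (Store ''x'' (Const 0) (Get ''nodes'' (Var ''k'')) ;;
   Store ''cnt'' (Var ''x'') (Add (Get ''cnt'' (Var ''x'')) (Const 1)))"

abbreviation "start_loop \<equiv> For ''x'' (Var ''n'')
  (Store ''fill'' (Var ''x'') (Get ''start'' (Var ''x'')) ;;
   Store ''start'' (Add (Var ''x'') (Const 1))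
     (Add (Get ''start'' (Var ''x'')) (Get ''cnt'' (Var ''x''))))"

abbreviation "root_loop \<equiv> For ''i'' (Var ''n'')
  (Store ''x'' (Const 0) (Get ''root'' (Var ''i'')) ;;
   Store ''pos'' (Var ''i'') (Get ''fill'' (Var ''x'')) ;;
   Store ''bucket'' (Get ''fill'' (Var ''x'')) (Var ''i'') ;;
   Store ''fill'' (Var ''x'') (Add (Get ''fill'' (Var ''x'')) (Const 1)))"

abbreviation "mid_loop \<equiv>
  For ''x'' (Var ''n'') (Store ''mid'' (Var ''x'') (Get ''fill'' (Var ''x'')))"

abbreviation "rest_loop_inner \<equiv> For ''k'' (subtree_size (Var ''i''))
  (Store ''x'' (Const 0) (subtree_node (Var ''i'') (Var ''k'')) ;;
   If (Sub (Var ''x'') (Get ''root'' (Var ''i'')))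
     (Store ''bucket'' (Get ''fill'' (Var ''x'')) (Var ''i'') ;;
      Store ''fill'' (Var ''x'') (Add (Get ''fill'' (Var ''x'')) (Const 1)))
     Skip)"

abbreviation "rest_loop \<equiv> For ''i'' (Var ''n'') rest_loop_inner"

lemma wp_zero_loop:
  assumes "input s"
  shows "wp zero_loop (\<lambda>s' t. (\<forall>x<n. s' ''cnt'' x = 0) \<and> t \<le> 3 + 10 * n) s"
proof (rule wp_For[where I = "\<lambda>x s' t. (\<forall>y<x. s' ''cnt'' y = 0) \<and> t \<le> 10 * x"], goal_cases)
  case (2 x s' t)
  then show ?case
    by (auto simp: wp_simps put_apply)
next
  case (3 s' t)
  then show ?case
    using assms by (simp add: input_simps)
qed simp

lemma wp_count_loop:
  assumes "input s" "\<forall>x<n. s ''cnt'' x = 0"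
  shows "wp count_loop
    (\<lambda>s' t. (\<forall>x<n. s' ''cnt'' x = card (containing x)) \<and> t \<le> 4 + 40 * off n) s"
proof (rule wp_For[where I = "\<lambda>k s' t.
    (\<forall>x<n. s' ''cnt'' x = count_list (take k (concat Ts)) x) \<and> t \<le> 40 * k"], goal_cases)
  case (2 k s' t)
  then have k: "k < off n" "s' ''nodes'' k = concat Ts ! k"
    using assms by (auto simp: input_def)
  then have "take (Suc k) (concat Ts) = take k (concat Ts) @ [concat Ts ! k]"
    by (simp add: take_Suc_conv_app_nth off_n)
  then show ?case
    using 2 k by (simp add: wp_simps put_apply count_list_append)
next
  case (3 s' t)
  then show ?case
    using assms by (simp add: input_simps count_concat off_n)
qed (use assms in simp)

lemma wp_start_loop:
  assumes "input s" "\<forall>x<n. s ''cnt'' x = card (containing x)" "s ''start'' 0 = 0"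
  shows "wp start_loop (\<lambda>s' t. (\<forall>x\<le>n. s' ''start'' x = bstart x) \<and>
    (\<forall>x<n. s' ''fill'' x = bstart x) \<and> t \<le> 3 + 40 * n) s"
proof (rule wp_For[where I = "\<lambda>x s' t. (\<forall>y\<le>x. s' ''start'' y = bstart y) \<and>
    (\<forall>y<x. s' ''fill'' y = bstart y) \<and> t \<le> 40 * x"], goal_cases)
  case 1
  then show ?case
    using assms by (simp add: bstart_def)
next
  case (2 x s' t)
  have "x < n"
    using 2 assms by (simp add: input_simps)
  moreover have "s' ''cnt'' = s ''cnt''"
    using 2 by simp
  ultimately show ?case
    using 2 assms by (simp add: wp_simps put_apply bstart_Suc less_Suc_eq le_Suc_eq)
next
  case (3 s' t)
  then show ?case
    using assms by (simp add: input_simps)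
qed

text \<open>Entering every subtree at its root first makes those rooted at \<open>x\<close> an
  initial piece of block \<open>x\<close>. A recorded \<open>pos\<close> stays valid because it lies
  in the filled part.\<close>

lemma wp_root_loop:
  assumes "input s" "\<forall>i<n. s ''root'' i = rt i" "\<forall>x<n. s ''fill'' x = bstart x"
  shows "wp root_loop (\<lambda>s' t. blocks (s' ''fill'') (s' ''bucket'') rooted \<and>
    (\<forall>i<n. bstart (rt i) \<le> s' ''pos'' i \<and> s' ''pos'' i < s' ''fill'' (rt i) \<and>
       s' ''bucket'' (s' ''pos'' i) = i) \<and> t \<le> 3 + 60 * n) s"
proof (rule wp_For[where I = "\<lambda>i s' t.
    blocks (s' ''fill'') (s' ''bucket'') (\<lambda>x. {i'. i' < i \<and> rt i' = x}) \<and>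
    (\<forall>i'<i. bstart (rt i') \<le> s' ''pos'' i' \<and> s' ''pos'' i' < s' ''fill'' (rt i') \<and>
       s' ''bucket'' (s' ''pos'' i') = i') \<and> t \<le> 60 * i"], goal_cases)
  case 1
  then show ?case
    using assms by (simp add: blocks_def bij_betw_def)
next
  case (2 i s' t)
  have i: "i < n"
    using 2 assms by (simp add: input_simps)
  let ?A = "\<lambda>x. {i'. i' < i \<and> rt i' = x}" and ?f = "s' ''fill''" and ?b = "s' ''bucket''"
  have blocks: "blocks ?f ?b ?A"
    using 2 by simp
  have sub: "?A x \<subseteq> containing x" for x
    using i rt_in by (auto simp: containing_def)
  note ins = blocks_insert[OF blocks sub rt_lt[OF i], of i]
  have new: "i \<in> containing (rt i)" "i \<notin> ?A (rt i)"
    using i rt_in by (auto simp: containing_def)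
  have A: "?A(rt i := insert i (?A (rt i))) = (\<lambda>x. {i'. i' < Suc i \<and> rt i' = x})"
    by (auto simp: fun_eq_iff less_Suc_eq)
  have "bstart (rt i) \<le> ?f (rt i)"
    using blocks rt_lt[OF i] by (simp add: blocks_def)
  \<comment> \<open>The new entry goes to a fresh cell, so it does not overwrite the recorded
    ones.\<close>
  moreover have "s' ''pos'' i' \<noteq> ?f (rt i)" if "i' < i" for i'
    using ins(2)[OF new, of "rt i'" "s' ''pos'' i'"] 2 that i rt_lt[of i'] by simp
  moreover have "s' ''pos'' i' < ?f (rt i)" if "rt i' = rt i" "i' < i" for i'
    using 2 that(2) unfolding that(1)[symmetric] by simp
  moreover have "s' ''root'' = s ''root''"
    using 2 by simp
  ultimately show ?case
    using 2 assms i ins(1)[OF new] A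
    by (simp add: wp_simps put_def less_Suc_eq)
next
  case (3 s' t)
  then show ?case
    using assms by (simp add: input_simps rooted_def[abs_def])
qed

text \<open>A snapshot between the two filling loops: at this moment \<open>fill x\<close> is the
  end of the part of block \<open>x\<close> with root \<open>x\<close>.\<close>

lemma wp_mid_loop:
  assumes "input s"
  shows "wp mid_loop (\<lambda>s' t. (\<forall>x<n. s' ''mid'' x = s' ''fill'' x) \<and> t \<le> 3 + 10 * n) s"
proof (rule wp_For[where I = "\<lambda>x s' t. (\<forall>y<x. s' ''mid'' y = s ''fill'' y) \<and> t \<le> 10 * x"],
    goal_cases)
  case (2 x s' t)
  then show ?case
    by (auto simp: wp_simps put_apply)
next
  case (3 s' t)
  then show ?case
    using assms by (simp add: input_simps)
qed simp

lemma wp_rest_loop: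
  assumes inp: "input s" and root: "\<forall>i<n. s ''root'' i = rt i"
    and blocks: "blocks (s ''fill'') (s ''bucket'') rooted"
  shows "wp rest_loop (\<lambda>s' t. blocks (s' ''fill'') (s' ''bucket'') containing \<and>
    (\<forall>x<n. s ''fill'' x \<le> s' ''fill'' x \<and>
      (\<forall>p. bstart x \<le> p \<and> p < s ''fill'' x \<longrightarrow> s' ''bucket'' p = s ''bucket'' p)) \<and>
    t \<le> 3 + 100 * n + 100 * off n) s"
proof -
  \<comment> \<open>Protects the rooted parts, to which \<open>mid\<close> and \<open>pos\<close>
    refer.\<close>
  define kept where "kept f b \<longleftrightarrow> (\<forall>x<n. s ''fill'' x \<le> f x \<and>
      (\<forall>p. bstart x \<le> p \<and> p < s ''fill'' x \<longrightarrow> b p = s ''bucket'' p))"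
    for f b :: "nat \<Rightarrow> nat"
  \<comment> \<open>\<open>A i\<close> is the filling before round \<open>i\<close> of the outer
    loop; \<open>B i k\<close> below is the filling after \<open>k\<close> further nodes of subtree
    \<open>i\<close>.\<close>
  define A where "A i x = rooted x \<union> {i'. i' < i \<and> x \<in> set (Ts ! i')}" for i x
  define B where "B i k x = A i x \<union> (if x \<in> set (take k (Ts ! i)) then {i} else {})" for i k x
  have inner: "wp rest_loop_inner (\<lambda>s' t. blocks (s' ''fill'') (s' ''bucket'') (A (Suc i)) \<and>
      kept (s' ''fill'') (s' ''bucket'') \<and> t \<le> 12 + 60 * length (Ts ! i)) r"
    if i: "i < n" and r: "input r" "r ''i'' 0 = i" "r ''root'' = s ''root''" "kept (r ''fill'') (r ''bucket'')"
      "blocks (r ''fill'') (r ''bucket'') (A i)" for i r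
  proof (rule wp_For[where I = "\<lambda>k r' t'. blocks (r' ''fill'') (r' ''bucket'') (B i k) \<and>
      kept (r' ''fill'') (r' ''bucket'') \<and> t' \<le> 60 * k"], goal_cases)
    case 1
    then show ?case
      using r by (simp add: B_def[abs_def])
  next
    case (2 k r' t')
    have k: "k < length (Ts ! i)"
      using 2 i r by (simp add: input_simps)
    have inp': "input r'" "r' ''i'' 0 = i" "r' ''root'' i = rt i"
      using input_cong[OF r(1)] 2 r root i by simp_all
    let ?y = "Ts ! i ! k" and ?f = "r' ''fill''" and ?b = "r' ''bucket''"
    have y: "?y < n" "i \<in> containing ?y" "rt i \<le> ?y"
      using nth_lt i k rt_le by (auto simp: containing_def)
    have take: "set (take (Suc k) (Ts ! i)) = insert ?y (set (take k (Ts ! i)))"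
      using k by (simp add: take_Suc_conv_app_nth)
    show ?case
    proof (cases "rt i < ?y")
      case True
      have "B i k x \<subseteq> containing x" for x
        using rooted_subset[of x] i set_take_subset[of k "Ts ! i"]
        by (auto simp: A_def B_def containing_def)
      \<comment> \<open>Subtree \<open>i\<close> is not yet in block \<open>?y\<close>: its list has
        no repetitions and its root is a different node.\<close>
      moreover have "?y \<notin> set (take k (Ts ! i))"
        using distinct[OF i] k by (auto simp: in_set_conv_nth nth_eq_iff_index_eq)
      then have "i \<notin> B i k ?y"
        using True by (auto simp: A_def B_def rooted_def)
      ultimately have ins: "blocks (?f(?y := Suc (?f ?y))) (?b(?f ?y := i))
          ((B i k)(?y := insert i (B i k ?y)))"
        "x < n \<Longrightarrow> bstart x \<le> p \<Longrightarrow> p < ?f x \<Longrightarrow> p \<noteq> ?f ?y" for x p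
        using blocks_insert[of ?f ?b "B i k" ?y i] 2 y by auto
      have "(B i k)(?y := insert i (B i k ?y)) = B i (Suc k)"
        by (auto simp: B_def fun_eq_iff take)
      moreover have "kept (?f(?y := Suc (?f ?y))) (?b(?f ?y := i))"
        using 2 ins(2) unfolding kept_def by (fastforce dest: less_le_trans)
      ultimately show ?thesis
        using 2 k i inp' r True ins(1) by (simp add: wp_simps put_def input_simps)
    next
      case False
      \<comment> \<open>Here \<open>?y\<close> is the root of subtree \<open>i\<close>, and
        \<open>i\<close> was already entered in that block as a rooted subtree.\<close>
      then have "B i (Suc k) = B i k"
        using y i by (auto simp: B_def A_def rooted_def fun_eq_iff take)
      then show ?thesis
        using 2 k i inp' r False y
        by (simp add: wp_simps put_def input_simps)
    qed
  next
    case (3 r' t')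
    have "B i (length (Ts ! i)) = A (Suc i)"
      by (auto simp: B_def A_def fun_eq_iff less_Suc_eq)
    then show ?case
      using 3 i r by (simp add: input_simps)
  qed
  show ?thesis
  proof (rule wp_For[where I = "\<lambda>i s' t. blocks (s' ''fill'') (s' ''bucket'') (A i) \<and>
      kept (s' ''fill'') (s' ''bucket'') \<and> t \<le> 100 * i + 100 * off i"], goal_cases)
    case 1
    then show ?case
      using blocks by (simp add: A_def[abs_def] kept_def off_0)
  next
    case (2 i s' t)
    have i: "i < n"
      using 2 inp by (simp add: input_simps)
    show ?case
    proof (rule wp_mono[OF inner[OF i]], goal_cases)
      case 1
      then show ?case
        using input_cong[OF inp] 2 by (simp add: put_other)
    next
      case (6 s'' t')
      then show ?case
        using 2 i by (simp add: off_Suc)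
    qed (use 2 in \<open>simp_all add: put_apply put_other\<close>)
  next
    case (3 s' t)
    have "A n x = containing x" for x
      using rooted_subset[of x] by (auto simp: A_def containing_def)
    then have "A n = containing" ..
    then show ?case
      using 3 inp by (simp add: input_simps kept_def)
  qed
qed

text \<open>The interface between filling the buckets and reading them: all that the adjacency lists
  require of \<open>start\<close>, \<open>mid\<close>, \<open>pos\<close> and
  \<open>bucket\<close>.\<close>

definition bucketed :: "mem \<Rightarrow> bool" where
  "bucketed s \<longleftrightarrow> (\<forall>x\<le>n. s ''start'' x = bstart x) \<and>
     (\<forall>x<n. s ''mid'' x \<le> bstart (Suc x) \<and>
        bij_betw (s ''bucket'') {bstart x..<bstart (Suc x)} (containing x) \<and>
        bij_betw (s ''bucket'') {bstart x..<s ''mid'' x} (rooted x)) \<and>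
     (\<forall>i<n. bstart (rt i) \<le> s ''pos'' i \<and> s ''pos'' i < s ''mid'' (rt i) \<and>
        s ''bucket'' (s ''pos'' i) = i)"

lemma wp_buckets:
  assumes inp: "input s" and root: "\<forall>i<n. s ''root'' i = rt i"
  shows "wp buckets_prog (\<lambda>s' t. bucketed s' \<and> t \<le> 30 + 300 * n + 300 * off n) s"
  unfolding buckets_prog_def
proof (rule wp_Seq[OF wp_zero_loop[OF inp]])
  fix s1 t1
  assume 1: "(\<forall>x<n. s1 ''cnt'' x = 0) \<and> t1 \<le> 3 + 10 * n"
    and fr1: "\<And>a. a \<notin> writes zero_loop \<Longrightarrow> s1 a = s a"
  have inp1: "input s1"
    using input_cong[OF inp] fr1 by simp
  let ?R = "\<lambda>s' t. bucketed s' \<and> t \<le> 30 + 300 * n + 300 * off n"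
  show "wp (count_loop ;; Store ''start'' (Const 0) (Const 0) ;; start_loop ;; root_loop ;;
      mid_loop ;; rest_loop) (\<lambda>s' t. ?R s' (t1 + t)) s1"
  proof (rule wp_Seq[OF wp_count_loop[OF inp1]])
    show "\<forall>x<n. s1 ''cnt'' x = 0"
      using 1 by simp
  next
    fix s2 t2
    assume 2: "(\<forall>x<n. s2 ''cnt'' x = card (containing x)) \<and> t2 \<le> 4 + 40 * off n"
      and fr2: "\<And>a. a \<notin> writes count_loop \<Longrightarrow> s2 a = s1 a"
    let ?s = "put ''start'' 0 0 s2"
    have inp2: "input ?s"
      using input_cong[OF inp1] fr2 by (simp add: put_other)
    \<comment> \<open>The 3 is the cost of storing the start of the first block.\<close>
    have "wp (start_loop ;; root_loop ;; mid_loop ;; rest_loop)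
        (\<lambda>s' t. ?R s' (t1 + (t2 + (3 + t)))) ?s"
    proof (rule wp_Seq[OF wp_start_loop[OF inp2]])
      show "\<forall>x<n. ?s ''cnt'' x = card (containing x)" "?s ''start'' 0 = 0"
        using 2 by (simp_all add: put_apply)
    next
      fix s3 t3
      assume 3: "(\<forall>x\<le>n. s3 ''start'' x = bstart x) \<and> (\<forall>x<n. s3 ''fill'' x = bstart x) \<and>
          t3 \<le> 3 + 40 * n"
        and fr3: "\<And>a. a \<notin> writes start_loop \<Longrightarrow> s3 a = ?s a"
      have inp3: "input s3"
        using input_cong[OF inp2] fr3 by simp
      have root3: "s3 ''root'' = s ''root''"
        using fr1 fr2 fr3 by (simp add: put_other)
      show "wp (root_loop ;; mid_loop ;; rest_loop)
          (\<lambda>s' t. ?R s' (t1 + (t2 + (3 + (t3 + t))))) s3"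
      proof (rule wp_Seq[OF wp_root_loop[OF inp3]])
        show "\<forall>i<n. s3 ''root'' i = rt i" "\<forall>x<n. s3 ''fill'' x = bstart x"
          using root root3 3 by simp_all
      next
        fix s4 t4
        assume 4: "blocks (s4 ''fill'') (s4 ''bucket'') rooted \<and>
            (\<forall>i<n. bstart (rt i) \<le> s4 ''pos'' i \<and> s4 ''pos'' i < s4 ''fill'' (rt i) \<and>
              s4 ''bucket'' (s4 ''pos'' i) = i) \<and> t4 \<le> 3 + 60 * n"
          and fr4: "\<And>a. a \<notin> writes root_loop \<Longrightarrow> s4 a = s3 a"
        have inp4: "input s4"
          using input_cong[OF inp3] fr4 by simp
        show "wp (mid_loop ;; rest_loop)
            (\<lambda>s' t. ?R s' (t1 + (t2 + (3 + (t3 + (t4 + t)))))) s4"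
        proof (rule wp_Seq[OF wp_mid_loop[OF inp4]])
          fix s5 t5
          assume 5: "(\<forall>x<n. s5 ''mid'' x = s5 ''fill'' x) \<and> t5 \<le> 3 + 10 * n"
            and fr5: "\<And>a. a \<notin> writes mid_loop \<Longrightarrow> s5 a = s4 a"
          have inp5: "input s5"
            using input_cong[OF inp4] fr5 by simp
          show "wp rest_loop
              (\<lambda>s' t. ?R s' (t1 + (t2 + (3 + (t3 + (t4 + (t5 + t))))))) s5"
          proof (rule wp_mono[OF wp_rest_loop[OF inp5]])
            show "\<forall>i<n. s5 ''root'' i = rt i"
              using root root3 fr4 fr5 by simp
            show "blocks (s5 ''fill'') (s5 ''bucket'') rooted"
              using 4 fr5 by simp
          next
            fix s6 t6
            assume 6: "blocks (s6 ''fill'') (s6 ''bucket'') containing \<and>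
                (\<forall>x<n. s5 ''fill'' x \<le> s6 ''fill'' x \<and>
                  (\<forall>p. bstart x \<le> p \<and> p < s5 ''fill'' x \<longrightarrow> s6 ''bucket'' p = s5 ''bucket'' p)) \<and>
                t6 \<le> 3 + 100 * n + 100 * off n"
              and fr6: "\<And>a. a \<notin> writes rest_loop \<Longrightarrow> s6 a = s5 a"
            have arrays: "s6 ''start'' = s3 ''start''" "s6 ''mid'' = s5 ''mid''"
              "s6 ''pos'' = s4 ''pos''" "s5 ''fill'' = s4 ''fill''" "s5 ''bucket'' = s4 ''bucket''"
              using fr4 fr5 fr6 by simp_all
            \<comment> \<open>After the last loop every block is filled up to the start of the next
              one.\<close>
            have full: "s6 ''fill'' x = bstart (Suc x)" if "x < n" for x
              using block_end[OF conjunct1[OF 6] that] by (simp add: bstart_Suc)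
            \<comment> \<open>The rooted part ends at \<open>mid x\<close>, and below it the last
              loop has changed nothing.\<close>
            have "bij_betw (s6 ''bucket'') {bstart x..<s5 ''mid'' x} (rooted x)" if "x < n" for x
            proof -
              have "bij_betw (s4 ''bucket'') {bstart x..<s5 ''mid'' x} (rooted x)"
                using 4 5 that arrays by (simp add: blocks_def)
              then show ?thesis
                using 5 6 that arrays by (subst bij_betw_cong[of _ _ "s4 ''bucket''"]) auto
            qed
            moreover have "s6 ''bucket'' (s4 ''pos'' i) = i" if "i < n" for i
              using 4 6 that arrays rt_lt[OF that] by simp
            ultimately have "bucketed s6"
              using 3 4 5 6 arrays full rt_lt by (auto simp: bucketed_def blocks_def)
            then show "?R s6 (t1 + (t2 + (3 + (t3 + (t4 + (t5 + t6))))))"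
              using 1 2 3 4 5 6 by simp
          qed
        qed
      qed
    qed
    then show "wp (Store ''start'' (Const 0) (Const 0) ;; start_loop ;; root_loop ;;
        mid_loop ;; rest_loop) (\<lambda>s' t. ?R s' (t1 + (t2 + t))) s2"
      unfolding wp_simps(2) wp_simps(3)[of "Store _ _ _"] by simp
  qed
qed

end


section \<open>Adjacency lists\<close>

text \<open>Several segments may be empty and hence equal as lists, so disjointness is required for
  different indices rather than for different lists.\<close>

lemma distinct_concat_map:
  assumes "distinct xs" "\<And>x. x \<in> set xs \<Longrightarrow> distinct (f x)"
    and "\<And>x y. x \<in> set xs \<Longrightarrow> y \<in> set xs \<Longrightarrow> x \<noteq> y \<Longrightarrow> set (f x) \<inter> set (f y) = {}"
  shows "distinct (concat (map f xs))"
  using assms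
proof (induction xs)
  case (Cons x xs)
  then have "set (f x) \<inter> set (f y) = {}" if "y \<in> set xs" for y
    using that by (metis distinct.simps(2) list.set_intros)
  moreover have "distinct (concat (map f xs))"
    using Cons by simp
  ultimately show ?case
    using Cons.prems(2)[of x] by auto
qed simp

context subtree_family
begin

section \<open>Recording the segment bounds\<close>

abbreviation "adjacency_loop_inner \<equiv> For ''k'' (subtree_size (Var ''i''))
  (Store ''x'' (Const 0) (subtree_node (Var ''i'') (Var ''k'')) ;;
   Store ''j'' (Const 0) (Add (Get ''adj'' (Var ''i'')) (Var ''k'')) ;;
   Store ''lo'' (Var ''j'') (Get ''start'' (Var ''x'')) ;;
   If (Sub (Var ''x'') (Get ''root'' (Var ''i'')))
     (Store ''hi'' (Var ''j'') (Get ''mid'' (Var ''x'')))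
     (Store ''hi'' (Var ''j'') (Get ''pos'' (Var ''i''))))"

abbreviation "adjacency_loop \<equiv> For ''i'' (Var ''n'')
    (Store ''adj'' (Var ''i'') (Add (Get ''off'' (Var ''i'')) (Var ''i'')) ;;
     adjacency_loop_inner ;;
     Store ''j'' (Const 0)
       (Add (Get ''adj'' (Var ''i'')) (subtree_size (Var ''i''))) ;;
     Store ''lo'' (Var ''j'') (Add (Get ''pos'' (Var ''i'')) (Const 1)) ;;
     Store ''hi'' (Var ''j'')
       (Get ''start'' (Add (Get ''root'' (Var ''i'')) (Const 1))))"

text \<open>A node other than the root contributes the rooted part of its block. The block of the
  root is cut at \<open>pos i\<close> to leave out \<open>i\<close> itself: the root's segment is
  the piece before, and the extra segment numbered \<open>length (Ts ! i)\<close> is the piece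
  after.\<close>

definition seg_lo :: "mem \<Rightarrow> nat \<Rightarrow> nat \<Rightarrow> nat" where
  "seg_lo s i k = (if k < length (Ts ! i) then bstart (Ts ! i ! k) else Suc (s ''pos'' i))"

definition seg_hi :: "mem \<Rightarrow> nat \<Rightarrow> nat \<Rightarrow> nat" where
  "seg_hi s i k =
     (if k < length (Ts ! i)
      then if rt i < Ts ! i ! k then s ''mid'' (Ts ! i ! k) else s ''pos'' i
      else bstart (Suc (rt i)))"

text \<open>The numbers of vertex \<open>i\<close> start at \<open>off i + i\<close>, as each
  earlier vertex uses one segment more than its size. \<open>s'\<close> holds the bounds, which are
  expressed by \<open>mid\<close> and \<open>pos\<close> of \<open>s\<close>.\<close>

definition segments :: "mem \<Rightarrow> mem \<Rightarrow> nat \<Rightarrow> nat \<Rightarrow> bool" where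
  "segments s s' i m \<longleftrightarrow>
     (\<forall>k<m. s' ''lo'' (off i + i + k) = seg_lo s i k \<and> s' ''hi'' (off i + i + k) = seg_hi s i k)"

lemma segments_below:
  assumes "i' < i" "i \<le> n" "k \<le> length (Ts ! i')"
  shows "off i' + i' + k < off i + i"
proof -
  have "off i' + length (Ts ! i') \<le> off i"
    using assms(1,2)
  proof (induction i)
    case (Suc i)
    then show ?case
      by (cases "i' = i") (auto simp: off_Suc)
  qed simp
  with assms show ?thesis
    by simp
qed

lemma segments_keep:
  assumes "segments s r i' (Suc (length (Ts ! i')))" "i' < i" "i \<le> n"
    and "\<forall>j<off i + i. r' ''lo'' j = r ''lo'' j \<and> r' ''hi'' j = r ''hi'' j"
  shows "segments s r' i' (Suc (length (Ts ! i')))"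
  using assms segments_below by (simp add: segments_def)

lemma wp_adjacency_loop_inner:
  assumes i: "i < n" and inp: "input r" and "r ''i'' 0 = i" "r ''adj'' i = off i + i"
    and root: "r ''root'' i = rt i" and start: "\<forall>x\<le>n. r ''start'' x = bstart x"
    and "r ''mid'' = s ''mid''" "r ''pos'' = s ''pos''"
  shows "wp adjacency_loop_inner (\<lambda>r' t. segments s r' i (length (Ts ! i)) \<and>
    (\<forall>j<off i + i. r' ''lo'' j = r ''lo'' j \<and> r' ''hi'' j = r ''hi'' j) \<and>
    t \<le> 12 + 60 * length (Ts ! i)) r"
proof (rule wp_For[where I = "\<lambda>k r' t. segments s r' i k \<and>
    (\<forall>j<off i + i. r' ''lo'' j = r ''lo'' j \<and> r' ''hi'' j = r ''hi'' j) \<and> t \<le> 60 * k"],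
    goal_cases)
  case (2 k r' t)
  have k: "k < length (Ts ! i)"
    using 2 assms by (simp add: input_simps)
  have "rt i \<le> Ts ! i ! k"
    using k by (simp add: rt_le)
  then show ?case
    using 2 k assms nth_lt[OF i k]
    by (simp add: wp_simps put_apply input_simps segments_def less_Suc_eq seg_lo_def seg_hi_def)
next
  case (3 r' t)
  then show ?case
    using assms by (simp add: input_simps)
qed (simp add: segments_def)

lemma wp_adjacency:
  assumes inp: "input s" and root: "\<forall>i<n. s ''root'' i = rt i" and bucketed: "bucketed s"
  shows "wp adjacency_prog (\<lambda>s' t. (\<forall>i\<le>n. s' ''adj'' i = off i + i) \<and>
    (\<forall>i<n. segments s s' i (Suc (length (Ts ! i)))) \<and> t \<le> 20 + 200 * n + 200 * off n) s"
  unfolding adjacency_prog_def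
proof (rule wp_Seq[rotated])
  fix s' t
  assume "(\<forall>i<n. s' ''adj'' i = off i + i) \<and>
      (\<forall>i<n. segments s s' i (Suc (length (Ts ! i)))) \<and> t \<le> 3 + 200 * n + 200 * off n"
    and "\<And>a. a \<notin> writes adjacency_loop \<Longrightarrow> s' a = s a"
  \<comment> \<open>The final store supplies \<open>adj n\<close>, which ends the list of the last
    vertex.\<close>
  then show "wp (Store ''adj'' (Var ''n'') (Add (Get ''off'' (Var ''n'')) (Var ''n'')))
      (\<lambda>s'' t'. (\<forall>i\<le>n. s'' ''adj'' i = off i + i) \<and>
        (\<forall>i<n. segments s s'' i (Suc (length (Ts ! i)))) \<and>
        t + t' \<le> 20 + 200 * n + 200 * off n) s'"
    using inp by (simp add: wp_simps put_apply input_simps segments_def)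
next
  show "wp adjacency_loop
       (\<lambda>s' t. (\<forall>i<n. s' ''adj'' i = off i + i) \<and>
      (\<forall>i<n. segments s s' i (Suc (length (Ts ! i)))) \<and> t \<le> 3 + 200 * n + 200 * off n) s"
  proof (rule wp_For[where I = "\<lambda>i s' t. (\<forall>i'<i. s' ''adj'' i' = off i' + i') \<and>
      (\<forall>i'<i. segments s s' i' (Suc (length (Ts ! i')))) \<and> t \<le> 200 * i + 200 * off i"], goal_cases)
    case (2 i s' t)
    have i: "i < n"
      using 2 inp by (simp add: input_simps)
    have inp': "input s'"
      using input_cong[OF inp] 2 by simp
    let ?r = "put ''adj'' i (off i + i) (put ''i'' 0 i s')"
    have inp_r: "input ?r"
      using input_cong[OF inp'] by (simp add: put_other)
    have start: "\<forall>x\<le>n. s ''start'' x = bstart x"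
      using bucketed by (simp add: bucketed_def)
    have unchanged: "s' ''root'' = s ''root''" "s' ''start'' = s ''start''"
      "s' ''mid'' = s ''mid''" "s' ''pos'' = s ''pos''"
      using 2 by simp_all
    have inner: "wp adjacency_loop_inner (\<lambda>r' t. segments s r' i (length (Ts ! i)) \<and>
        (\<forall>j<off i + i. r' ''lo'' j = ?r ''lo'' j \<and> r' ''hi'' j = ?r ''hi'' j) \<and>
        t \<le> 12 + 60 * length (Ts ! i)) ?r"
      using root start i unchanged
      by (intro wp_adjacency_loop_inner inp_r) (simp_all add: put_apply put_other)
    have "val (Var ''i'') (put ''i'' 0 i s') = i"
      "val (Add (Get ''off'' (Var ''i'')) (Var ''i'')) (put ''i'' 0 i s') = off i + i"
      using inp' i by (simp_all add: put_apply input_simps)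
    then show ?case
      unfolding wp_simps(3)[of "Store _ _ _"] wp_simps(3)[of adjacency_loop_inner] wp_simps(2)
    proof (simp only:, intro wp_mono[OF inner], goal_cases)
      case (1 s'' t')
      have inp'': "input s''" "s'' ''i'' 0 = i" "s'' ''adj'' = ?r ''adj''"
        "s'' ''start'' = s ''start''" "s'' ''root'' = s ''root''" "s'' ''pos'' = s ''pos''"
        using input_cong[OF inp_r] 1 unchanged by (simp_all add: put_apply put_other)
      let ?j = "off i + i + length (Ts ! i)"
      \<comment> \<open>The memory at the end of the round, with the extra segment stored at
        \<open>?j\<close>.\<close>
      let ?t = "put ''hi'' ?j (bstart (Suc (rt i))) (put ''lo'' ?j (Suc (s ''pos'' i))
          (put ''j'' 0 ?j s''))"
      have "segments s ?t i (Suc (length (Ts ! i)))"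
        using 1 by (simp add: segments_def put_apply less_Suc_eq seg_lo_def seg_hi_def)
      moreover have "segments s ?t i' (Suc (length (Ts ! i')))" if "i' < i" for i'
      proof (rule segments_keep[OF _ that])
        show "segments s s' i' (Suc (length (Ts ! i')))" "i \<le> n"
          using 2 that i by simp_all
        show "\<forall>j<off i + i. ?t ''lo'' j = s' ''lo'' j \<and> ?t ''hi'' j = s' ''hi'' j"
          using 1 by (simp add: put_apply)
      qed
      ultimately have segs: "\<forall>i'<Suc i. segments s ?t i' (Suc (length (Ts ! i')))"
        by (auto simp: less_Suc_eq)
      have adjs: "\<forall>i'<Suc i. ?t ''adj'' i' = off i' + i'"
        using 2 inp''(3) by (auto simp: put_apply less_Suc_eq)
      have time: "t \<le> 200 * i + 200 * off i" "t' \<le> 12 + 60 * length (Ts ! i)"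
        using 1 2 by simp_all
      have vals:
        "val (Add (Get ''adj'' (Var ''i'')) (subtree_size (Var ''i''))) s'' = ?j"
        "val (Var ''j'') (put ''j'' 0 ?j s'') = ?j"
        "val (Add (Get ''pos'' (Var ''i'')) (Const 1)) (put ''j'' 0 ?j s'') = Suc (s ''pos'' i)"
        "val (Var ''j'') (put ''lo'' ?j (Suc (s ''pos'' i)) (put ''j'' 0 ?j s'')) = ?j"
        "val (Get ''start'' (Add (Get ''root'' (Var ''i'')) (Const 1)))
           (put ''lo'' ?j (Suc (s ''pos'' i)) (put ''j'' 0 ?j s'')) = bstart (Suc (rt i))"
        using inp'' i root start rt_lt[OF i] by (simp_all add: put_apply input_simps)
      show ?case
        using segs adjs time i
        by (simp only: wp_simps vals val.simps(1)) (simp add: off_Suc)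
    qed
  next
    case (3 s' t)
    then show ?case
      using inp by (simp add: input_simps)
  qed (simp add: off_0)
qed

text \<open>The two pieces of the block of \<open>r\<close> list the other subtrees containing
  \<open>r\<close>. The remaining segments list subtrees with a root above \<open>r\<close>; these
  do not contain \<open>r\<close>, and different segments have different roots. So nothing is
  repeated, and the hypothesis \<open>root\<close> shows that no neighbour is missed.\<close>

lemma adjacency_list_correct:
  assumes i: "i < n" and bucketed: "bucketed s" and same: "s' ''bucket'' = s ''bucket''"
    and adj: "\<forall>i\<le>n. s' ''adj'' i = off i + i"
    and segs: "segments s s' i (Suc (length (Ts ! i)))"
    and root: "\<And>i j. (i, j) \<in> intersection_edges Ts \<Longrightarrow>
      rt i \<in> set (Ts ! j) \<or> rt j \<in> set (Ts ! i)"
  shows "distinct (adjacency_list s' i)"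
    and "set (adjacency_list s' i) = {j. (i, j) \<in> intersection_edges Ts}"
proof -
  define b p r m where "b = s ''bucket''" and "p = s ''pos'' i" and "r = rt i"
    and "m = length (Ts ! i)"
  define seg where "seg k = [seg_lo s i k..<seg_hi s i k]" for k
  have r: "r < n" "r \<in> set (Ts ! i)" "i \<in> containing r"
    using rt_lt rt_in i by (auto simp: r_def containing_def)
  have p: "bstart r \<le> p" "p < bstart (Suc r)" "b p = i"
    using bucketed i r by (auto simp: bucketed_def r_def p_def b_def intro: less_le_trans)
  have block: "bij_betw b {bstart x..<bstart (Suc x)} (containing x)"
    and root_block: "bij_betw b {bstart x..<s ''mid'' x} (rooted x)" if "x < n" for x
    using bucketed that by (auto simp: bucketed_def b_def)
  have inj: "inj_on b {bstart r..<bstart (Suc r)}"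
    using block[OF r(1)] by (rule bij_betw_imp_inj_on)
  have seg_node: "seg k = [bstart (Ts ! i ! k)..<s ''mid'' (Ts ! i ! k)]"
    if "k < m" "Ts ! i ! k \<noteq> r" for k
    using that rt_le[of "Ts ! i ! k" i]
    by (simp add: seg_def seg_lo_def seg_hi_def m_def r_def)
  have seg_root: "seg k = [bstart r..<p]" if "k < m" "Ts ! i ! k = r" for k
    using that by (simp add: seg_def seg_lo_def seg_hi_def m_def r_def p_def)
  have seg_last: "seg m = [Suc p..<bstart (Suc r)]"
    by (simp add: seg_def seg_lo_def seg_hi_def m_def r_def p_def)
  have node: "b ` set (seg k) = rooted (Ts ! i ! k)" "inj_on b (set (seg k))"
    if "k < m" "Ts ! i ! k \<noteq> r" for k
    using root_block[OF nth_lt[OF i]] that by (auto simp: seg_node bij_betw_def m_def)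
  \<comment> \<open>The segments taken from the block of \<open>r\<close>: the one of the root, at
    index \<open>k0\<close>, and the extra one.\<close>
  define near where "near k \<longleftrightarrow> k = m \<or> (k < m \<and> Ts ! i ! k = r)" for k
  obtain k0 where k0: "k0 < m" "Ts ! i ! k0 = r"
    using r(2) by (auto simp: in_set_conv_nth m_def)
  have near_sub: "set (seg k) \<subseteq> {bstart r..<bstart (Suc r)} - {p}" if "near k" for k
    using that p by (auto simp: near_def seg_root seg_last)
  have k0_only: "k = k0" if "k < m" "Ts ! i ! k = r" for k
    using that k0 distinct[OF i] nth_eq_iff_index_eq unfolding m_def by metis
  have "set (seg k0) \<union> set (seg m) = {bstart r..<bstart (Suc r)} - {p}"
    using p k0 by (auto simp: seg_root seg_last)
  then have "b ` set (seg k0) \<union> b ` set (seg m) = b ` ({bstart r..<bstart (Suc r)} - {p})"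
    by (metis image_Un)
  also have "\<dots> = containing r - {i}"
    using block[OF r(1)] inj p by (subst inj_on_image_set_diff[OF inj]) (auto simp: bij_betw_def)
  finally have near_image: "b ` set (seg k0) \<union> b ` set (seg m) = containing r - {i}" .
  have list: "adjacency_list s' i = concat (map (\<lambda>k. map b (seg k)) [0..<Suc m])"
  proof -
    have "s' ''adj'' i = off i + i" "s' ''adj'' (Suc i) = off i + i + Suc m"
      using adj i by (simp_all add: off_Suc m_def)
    then have "[s' ''adj'' i..<s' ''adj'' (Suc i)] = map (\<lambda>k. off i + i + k) [0..<Suc m]"
      by (simp only: map_add_upt add.commute[of "off i + i"])
    then have "adjacency_list s' i = concat (map ((\<lambda>j. map b [s' ''lo'' j..<s' ''hi'' j]) \<circ>
        (\<lambda>k. off i + i + k)) [0..<Suc m])"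
      by (simp only: adjacency_list_def same b_def map_map)
    also have "map ((\<lambda>j. map b [s' ''lo'' j..<s' ''hi'' j]) \<circ> (\<lambda>k. off i + i + k)) [0..<Suc m] =
        map (\<lambda>k. map b (seg k)) [0..<Suc m]"
      using segs by (intro map_cong) (auto simp: segments_def seg_def m_def)
    finally show ?thesis .
  qed
  show "distinct (adjacency_list s' i)"
    unfolding list
  proof (rule distinct_concat_map)
    fix k
    assume "k \<in> set [0..<Suc m]"
    then have "k \<le> m"
      by auto
    then have "inj_on b (set (seg k))"
      using node(2)[of k] inj_on_subset[OF inj] near_sub[of k]
      by (cases "near k") (blast, auto simp: near_def)
    then show "distinct (map b (seg k))"
      by (simp add: distinct_map seg_def)
  next
    fix k k'
    assume "k \<in> set [0..<Suc m]" "k' \<in> set [0..<Suc m]" and ne: "k \<noteq> k'"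
    then have le: "k \<le> m" "k' \<le> m"
      by auto
    have mixed: "b ` set (seg k) \<inter> b ` set (seg k') = {}"
      if "near k" "\<not> near k'" "k' \<le> m" for k k'
    proof -
      have k': "k' < m" "Ts ! i ! k' \<noteq> r"
        using that by (auto simp: near_def)
      have "b ` set (seg k) \<subseteq> containing r"
        using near_sub[OF that(1)] block[OF r(1)] by (auto simp: bij_betw_def)
      moreover have "r < Ts ! i ! k'"
        using k' rt_le[of "Ts ! i ! k'" i] by (simp add: r_def m_def)
      \<comment> \<open>The root is the smallest node, so a subtree rooted above \<open>r\<close>
        cannot contain \<open>r\<close>.\<close>
      then have "rooted (Ts ! i ! k') \<inter> containing r = {}"
        using rt_le by (force simp: rooted_def containing_def)
      ultimately show ?thesis
        using node(1)[OF k'] by auto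
    qed
    have "b ` set (seg k) \<inter> b ` set (seg k') = {}"
    proof (cases "near k \<longleftrightarrow> near k'")
      case False
      then show ?thesis
        using mixed le by (metis Int_commute)
    next
      case same: True
      show ?thesis
      proof (cases "near k")
        case True
        \<comment> \<open>One index is \<open>k0\<close> and the other is \<open>m\<close>; their
          segments lie on the two sides of \<open>p\<close>, and \<open>b\<close> is injective on
          the whole block.\<close>
        then have "set (seg k) \<inter> set (seg k') = {}"
          using same ne k0_only by (auto simp: near_def seg_root seg_last)
        then show ?thesis
          using near_sub True same inj
          by (subst inj_on_image_Int[OF inj, symmetric]) blast+
      next
        case False
        then have "k < m" "k' < m" "Ts ! i ! k \<noteq> r" "Ts ! i ! k' \<noteq> r"
          using same le by (auto simp: near_def)
        moreover have "Ts ! i ! k \<noteq> Ts ! i ! k'"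
          using calculation ne distinct[OF i] by (simp add: m_def nth_eq_iff_index_eq)
        ultimately show ?thesis
          using node(1) by (auto simp: rooted_def)
      qed
    qed
    then show "set (map b (seg k)) \<inter> set (map b (seg k')) = {}"
      by simp
  qed simp
  have "{..m} = set [0..<Suc m]"
    by auto
  then have "set (adjacency_list s' i) = (\<Union>k\<le>m. b ` set (seg k))"
    unfolding list by (simp del: upt_Suc set_upt)
  also have "\<dots> = (containing r - {i}) \<union> (\<Union>x\<in>set (Ts ! i) - {r}. rooted x)"
  proof -
    have "{..m} = {k0, m} \<union> {k. k < m \<and> Ts ! i ! k \<noteq> r}"
    proof (rule set_eqI)
      show "k \<in> {..m} \<longleftrightarrow> k \<in> {k0, m} \<union> {k. k < m \<and> Ts ! i ! k \<noteq> r}" for k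
        using k0 k0_only[of k] by auto
    qed
    then have "(\<Union>k\<le>m. b ` set (seg k)) =
        (containing r - {i}) \<union> (\<Union>k\<in>{k. k < m \<and> Ts ! i ! k \<noteq> r}. rooted (Ts ! i ! k))"
      using node(1) near_image by auto
    moreover have "set (Ts ! i) - {r} = (!) (Ts ! i) ` {k. k < m \<and> Ts ! i ! k \<noteq> r}"
      by (auto simp: set_conv_nth m_def)
    ultimately show ?thesis
      by simp
  qed
  also have "\<dots> = {j. (i, j) \<in> intersection_edges Ts}"
  proof -
    have edge: "(i, j) \<in> intersection_edges Ts \<longleftrightarrow>
        j < n \<and> i \<noteq> j \<and> set (Ts ! i) \<inter> set (Ts ! j) \<noteq> {}" for j
      using i by (simp add: intersection_edges_def length_Ts)
    have "(i, j) \<in> intersection_edges Ts \<longleftrightarrow>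
        j \<in> (containing r - {i}) \<union> (\<Union>x\<in>set (Ts ! i) - {r}. rooted x)" for j
    proof
      assume e: "(i, j) \<in> intersection_edges Ts"
      then have "r \<in> set (Ts ! j) \<or> rt j \<in> set (Ts ! i)" "j < n" "i \<noteq> j" "rt j \<in> set (Ts ! j)"
        using root rt_in by (auto simp: r_def edge)
      then show "j \<in> (containing r - {i}) \<union> (\<Union>x\<in>set (Ts ! i) - {r}. rooted x)"
        by (auto simp: containing_def rooted_def)
    next
      assume "j \<in> (containing r - {i}) \<union> (\<Union>x\<in>set (Ts ! i) - {r}. rooted x)"
      then show "(i, j) \<in> intersection_edges Ts"
        unfolding edge using r rt_in by (auto simp: containing_def rooted_def r_def)
    qed
    then show ?thesis
      by auto
  qed
  finally show "set (adjacency_list s' i) = {j. (i, j) \<in> intersection_edges Ts}" .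
qed

text \<open>The time bounds of the three passes add up: 100 + 300 + 200 is 600, and 3 + 30 + 20 is
  rounded up to 60.\<close>

lemma wp_intersection_graph:
  assumes inp: "input s"
    and root: "\<And>i j. (i, j) \<in> intersection_edges Ts \<Longrightarrow>
      rt i \<in> set (Ts ! j) \<or> rt j \<in> set (Ts ! i)"
  shows "wp intersection_graph_prog (\<lambda>s' t. holds_graph s' n (intersection_edges Ts) \<and>
    t \<le> 60 + 600 * n + 600 * off n) s"
  unfolding intersection_graph_prog_def
proof (rule wp_Seq[OF wp_roots[OF inp]])
  fix s1 t1
  assume 1: "(\<forall>i<n. s1 ''root'' i = rt i) \<and> t1 \<le> 3 + 100 * n + 100 * off n"
    and fr1: "\<And>a. a \<notin> writes roots_prog \<Longrightarrow> s1 a = s a"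
  have inp1: "input s1"
    using input_cong[OF inp] fr1 by (simp add: roots_prog_def)
  show "wp (buckets_prog ;; adjacency_prog) (\<lambda>s' t. holds_graph s' n (intersection_edges Ts) \<and>
      t1 + t \<le> 60 + 600 * n + 600 * off n) s1"
  proof (rule wp_Seq[OF wp_buckets[OF inp1]])
    fix s2 t2
    assume 2: "bucketed s2 \<and> t2 \<le> 30 + 300 * n + 300 * off n"
      and fr2: "\<And>a. a \<notin> writes buckets_prog \<Longrightarrow> s2 a = s1 a"
    have inp2: "input s2" "s2 ''root'' = s1 ''root''"
      using input_cong[OF inp1] fr2 by (simp_all add: buckets_prog_def)
    show "wp adjacency_prog (\<lambda>s' t. holds_graph s' n (intersection_edges Ts) \<and>
        t1 + (t2 + t) \<le> 60 + 600 * n + 600 * off n) s2"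
    proof (rule wp_mono[OF wp_adjacency[OF inp2(1)]])
      fix s' t
      assume 3: "(\<forall>i\<le>n. s' ''adj'' i = off i + i) \<and>
          (\<forall>i<n. segments s2 s' i (Suc (length (Ts ! i)))) \<and> t \<le> 20 + 200 * n + 200 * off n"
        and fr3: "\<And>a. a \<notin> writes adjacency_prog \<Longrightarrow> s' a = s2 a"
      have "s' ''bucket'' = s2 ''bucket''"
        using fr3 by (simp add: adjacency_prog_def)
      then have "holds_graph s' n (intersection_edges Ts)"
        using adjacency_list_correct[of _ s2 s'] 2 3 root by (simp add: holds_graph_def)
      then show "holds_graph s' n (intersection_edges Ts) \<and>
          t1 + (t2 + t) \<le> 60 + 600 * n + 600 * off n"
        using 1 2 3 by simp
    qed (use 1 2 inp2 in simp_all)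
  qed (use 1 in simp)
qed

end


section \<open>The random host tree and the complete run\<close>

lemma wp_host_tree:
  assumes "s ''n'' 0 = n"
  shows "wp host_tree_prog (\<lambda>s' t. s' ''n'' 0 = n \<and>
    (\<forall>k. 1 \<le> k \<longrightarrow> k < n \<longrightarrow> s' ''par'' k < k) \<and> t \<le> 10 + 20 * n) s"
  unfolding host_tree_prog_def
\<comment> \<open>Round \<open>m\<close> draws the parent of node \<open>m + 1\<close> from
  \<open>{0..m}\<close>, which gives the strict inequality.\<close>
proof (rule wp_For[where I = "\<lambda>m s' t. (\<forall>k. 1 \<le> k \<longrightarrow> k \<le> m \<longrightarrow> s' ''par'' k < k) \<and> t \<le> 20 * m"],
    goal_cases)
  case (2 m s' t)
  then show ?case
    by (intro wp_Rand) (simp_all add: put_apply le_Suc_eq)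
next
  case (3 s' t)
  have "s' ''n'' = s ''n''"
    using 3 by simp
  moreover have "k \<le> n - 1" if "k < n" for k
    using that by simp
  moreover have "t \<le> 20 * n"
    using conjunct2[OF 3(2)] assms by simp
  ultimately show ?case
    using 3(2) assms by simp
qed simp

lemma chordal_gen_outcome:
  assumes gen: "subtree_generator gen" and "n \<ge> 1"
    and outcome: "((T, Ts, s), t) \<in> set_pmf (chordal_gen gen p n)"
  obtains t' where "tree {..<n} T" "(Ts, t') \<in> set_pmf (gen p n T)"
    "holds_graph s n (intersection_edges Ts)" "chordal {..<n} (intersection_edges Ts)"
    "length Ts = n" "t \<le> t' + 1400 * (\<Sum>i<n. card (set (Ts ! i)))"
proof -
  from outcome obtain s1 t1 t' u where host: "(s1, t1) \<in> set_pmf (exec host_tree_prog (init_mem n))"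
    and T: "T = host_edges n (s1 ''par'')" and Ts: "(Ts, t') \<in> set_pmf (gen p n T)"
    and graph: "(s, u) \<in> set_pmf (exec intersection_graph_prog (store_subtrees Ts s1))"
    and t: "t = t1 + (t' + u)"
    by (auto simp: chordal_gen_def set_pmf_bind_time Let_def)
  have s1: "s1 ''n'' 0 = n" "\<And>k. 1 \<le> k \<Longrightarrow> k < n \<Longrightarrow> s1 ''par'' k < k" "t1 \<le> 10 + 20 * n"
    using wp_host_tree[of "init_mem n" n] host by (auto simp: wp_def init_mem_def put_apply)
  have tree: "tree {..<n} T"
    unfolding T using assms(2) s1(2) by (rule tree_host_edges)
  then have "length Ts = n \<and> (\<forall>us\<in>set Ts. subtree_nodes {..<n} T us)"
    using gen Ts unfolding subtree_generator_def by blast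
  then have len: "length Ts = n" and sub: "\<And>i. i < n \<Longrightarrow> subtree_nodes {..<n} T (Ts ! i)"
    by simp_all
  interpret subtree_family n Ts
    by unfold_locales (use len sub in \<open>simp_all add: subtree_nodes_def\<close>)
  \<comment> \<open>The tree structure enters here, both for the adjacency lists and for
    chordality.\<close>
  have root: "rt i \<in> set (Ts ! j) \<or> rt j \<in> set (Ts ! i)" if "(i, j) \<in> intersection_edges Ts" for i j
    unfolding rt_def
  proof (rule intersecting_subtrees_root[where par = "s1 ''par''" and n = n])
    show "connected_on (host_edges n (s1 ''par'')) (set (Ts ! i))"
      "connected_on (host_edges n (s1 ''par'')) (set (Ts ! j))" "set (Ts ! i) \<inter> set (Ts ! j) \<noteq> {}"
      using that sub[of i] sub[of j]
      by (auto simp: intersection_edges_def len T subtree_nodes_def)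
  qed (use s1(2) in auto)
  have "input (store_subtrees Ts s1)"
    using s1(1) by (simp add: input_def store_subtrees_def off_def length_Ts)
  from wp_intersection_graph[OF this root]
  have holds: "holds_graph s n (intersection_edges Ts)" and u: "u \<le> 60 + 600 * n + 600 * off n"
    using graph by (auto simp: wp_def)
  have off_eq: "off n = (\<Sum>i<n. card (set (Ts ! i)))"
    using distinct by (simp add: off_n length_concat sum_list_sum_nth length_Ts distinct_card
        atLeast0LessThan)
  have "(\<Sum>i<n. 1) \<le> (\<Sum>i<n. card (set (Ts ! i)))"
    using nonempty by (intro sum_mono) (simp add: Suc_le_eq card_gt_0_iff)
  then have "n \<le> off n"
    by (simp add: off_eq)
  \<comment> \<open>Apart from the generator, the time is at most
    \<open>70 + 620 * n + 600 * off n\<close>. As \<open>1 \<le> n \<le> off n\<close>, this is at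
    most \<open>1290 * off n\<close>.\<close>
  then have "t \<le> t' + 1400 * (\<Sum>i<n. card (set (Ts ! i)))"
    using t u s1(3) assms(2) by (simp flip: off_eq)
  moreover have "chordal {..<n} (intersection_edges Ts)"
    using root by (intro chordal_intersection_edges) (simp add: rt_def)
  ultimately show thesis
    using that tree Ts holds len by blast
qed

theorem theorem2:
  fixes gen :: "'p generator"
    and S :: "'p \<Rightarrow> nat \<Rightarrow> (nat \<times> nat) set \<Rightarrow> nat list list \<Rightarrow> real"
    and N :: nat
  assumes gen: "subtree_generator gen"
    and gen_time: "\<exists>c>0. \<forall>p. \<forall>n\<ge>N. \<forall>T. tree {..<n} T \<longrightarrow>
      (\<forall>(Ts, t)\<in>set_pmf (gen p n T). real t \<le> c * S p n T Ts)"
  shows "(\<forall>p. \<forall>n\<ge>1. \<forall>((T, Ts, s), t)\<in>set_pmf (chordal_gen gen p n).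
            let E = intersection_edges Ts in
              holds_graph s n E \<and> simple_graph {..<n} E \<and> chordal {..<n} E)
       \<and> (\<exists>C>0. \<forall>p. \<forall>n\<ge>max 1 N. \<forall>((T, Ts, s), t)\<in>set_pmf (chordal_gen gen p n).
            real t \<le> C * (S p n T Ts + (\<Sum>i<n. real (card (set (Ts ! i))))))"
proof (intro conjI)
  show "\<forall>p. \<forall>n\<ge>1. \<forall>((T, Ts, s), t)\<in>set_pmf (chordal_gen gen p n).
      let E = intersection_edges Ts in
        holds_graph s n E \<and> simple_graph {..<n} E \<and> chordal {..<n} E"
  proof (intro allI impI ballI, clarify)
    fix p T Ts s t and n :: nat
    assume "1 \<le> n" "((T, Ts, s), t) \<in> set_pmf (chordal_gen gen p n)"
    then show "let E = intersection_edges Ts in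
        holds_graph s n E \<and> simple_graph {..<n} E \<and> chordal {..<n} E"
      using simple_graph_intersection_edges
      by (elim chordal_gen_outcome[OF gen]) (auto simp: Let_def)
  qed
  from gen_time obtain c where "c > 0"
    and c: "\<And>p n T Ts t. n \<ge> N \<Longrightarrow> tree {..<n} T \<Longrightarrow> (Ts, t) \<in> set_pmf (gen p n T) \<Longrightarrow>
      real t \<le> c * S p n T Ts"
    by fast
  \<comment> \<open>The witness adds \<open>c\<close> for the generator and \<open>1400\<close> for
    the rest; the cross terms are harmless because \<open>S\<close> and the total size are
    nonnegative.\<close>
  show "\<exists>C>0. \<forall>p. \<forall>n\<ge>max 1 N. \<forall>((T, Ts, s), t)\<in>set_pmf (chordal_gen gen p n).
      real t \<le> C * (S p n T Ts + (\<Sum>i<n. real (card (set (Ts ! i)))))"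
  proof (intro exI[of _ "c + 1400"] conjI allI impI ballI, use \<open>c > 0\<close> in simp, clarify)
    fix p T Ts s t and n :: nat
    assume n: "max 1 N \<le> n" and outcome: "((T, Ts, s), t) \<in> set_pmf (chordal_gen gen p n)"
    let ?m = "\<Sum>i<n. card (set (Ts ! i))"
    obtain t' where t': "tree {..<n} T" "(Ts, t') \<in> set_pmf (gen p n T)" "t \<le> t' + 1400 * ?m"
      using n by (auto intro: chordal_gen_outcome[OF gen _ outcome])
    have le: "real t' \<le> c * S p n T Ts"
      using c t' n by simp
    \<comment> \<open>\<open>S\<close> is an arbitrary real function; its sign at this outcome comes
      from \<open>0 \<le> real t'\<close> and the bound by \<open>c * S p n T Ts\<close>.\<close>
    then have "0 \<le> S p n T Ts"
      using \<open>c > 0\<close> by (meson of_nat_0_le_iff order_trans zero_le_mult_iff not_less)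
    moreover have "real t \<le> real t' + 1400 * real ?m"
      using t'(3) by linarith
    moreover have "0 \<le> c * real ?m"
      using \<open>c > 0\<close> by (intro mult_nonneg_nonneg of_nat_0_le_iff) simp
    moreover have "(c + 1400) * (S p n T Ts + real ?m) =
        c * S p n T Ts + c * real ?m + 1400 * S p n T Ts + 1400 * real ?m"
      by (simp only: distrib_left distrib_right)
    ultimately have "real t \<le> (c + 1400) * (S p n T Ts + real ?m)"
      using le by linarith
    then show "real t \<le> (c + 1400) * (S p n T Ts + (\<Sum>i<n. real (card (set (Ts ! i)))))"
      by simp
  qed
qed

end
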